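(* Let $\varepsilon\in\{1,-1\}$ and let $\mathcal V^{\langle\varepsilon\rangle}$ be the variety of algebras over a field $F$ of characteristic $0$ defined by the identities $$(xy)(zt)=0,\qquad (x,y,z)=\varepsilon\,(x,z,y),\qquad \bigl\langle\langle x,y\rangle_\varepsilon,z\bigr\rangle_\varepsilon=0,$$ where $\langle x,y\rangle_\varepsilon=xy-\varepsilon yx$. Then the basic superrank of $\mathcal V^{\langle\varepsilon\rangle}$ is infinite, i.e. $\mathcal V^{\langle\varepsilon\rangle}_{r,s}\neq\tilde{\mathcal V}^{\langle\varepsilon\rangle}$ for all nonnegative integers $r,s$.
   Context: All algebras are over a field $F$ of characteristic $0$ and are not assumed associative or unital. $(x,y,z)=(xy)z-x(yz)$ is the associator. A superalgebra is a $\mathbb Z_2$-graded algebra $\mathcal A=\mathcal A_0+\mathcal A_1$, $\mathcal A_i\mathcal A_j\subseteq\mathcal A_{i+j \bmod 2}$. $\mathrm G=\mathrm G_0+\mathrm G_1$ is the Grassmann algebra on countably many anticommuting generators $e_1,e_2,\dots$ ($\mathrm G_0$, $\mathrm G_1$ spanned by words of even, resp. odd, length). The Grassmann envelope of $\mathcal A$ is $\mathrm G(\mathcal A)=\mathrm G_0\otimes\mathcal A_0+\mathrm G_1\otimes\mathcal A_1\subseteq \mathrm G\otimes\mathcal A$. For a multilinear polynomial $f$, its superization $\tilde f$ is obtained by the Koszul sign rule (a sign $(-1)^{ij}$ whenever a variable of parity $i$ passes through one of parity $j$); $\mathcal A$ satisfies the superidentity $\tilde f=0$ if and only if $\mathrm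 G(\mathcal A)$ satisfies $f=0$. For a variety $\mathcal V$, a $\mathcal V$-superalgebra is a superalgebra $\mathcal A$ with $\mathrm G(\mathcal A)\in\mathcal V$; $\tilde{\mathcal V}$ is the class of all $\mathcal V$-superalgebras. The supervariety generated by a superalgebra $\mathcal B$ is the class of all superalgebras satisfying every superidentity $\tilde f=0$ ($f$ multilinear) satisfied by $\mathcal B$. For nonnegative integers $(r,s)\ne(0,0)$, $\mathcal V_{r,s}$ is the supervariety generated by the free $\mathcal V$-superalgebra on $r$ even and $s$ odd generators; $\mathcal V_{0,0}=\{\{0\}\}$. *)

theory Defs
  imports
    "HOL-Algebra.Module"
    "HOL-Algebra.QuotRing"
    "HOL-Algebra.Algebraic_Closure_Type"
    "HOL-Library.Z2"
begin

text \<open>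
  The ground field is the type \<open>'k\<close>, viewed as a ring record through \<open>ring_of_type_algebra\<close>.
  Algebras are \<open>module\<close> records: carrier, addition, product and scalar multiplication are used;
  no axiom or identity below refers to the field \<open>one\<close>.
\<close>

locale nonassoc_algebra = module "ring_of_type_algebra :: 'k::field ring" A
  for A :: "('k::field, 'a, 'm) module_scheme" (structure) +
  assumes mult_closed: "\<lbrakk>x \<in> carrier A; y \<in> carrier A\<rbrakk> \<Longrightarrow> x \<otimes> y \<in> carrier A"
    and mult_add_left:
      "\<lbrakk>x \<in> carrier A; y \<in> carrier A; z \<in> carrier A\<rbrakk> \<Longrightarrow> (x \<oplus> y) \<otimes> z = x \<otimes> z \<oplus> y \<otimes> z"
    and mult_add_right:
      "\<lbrakk>x \<in> carrier A; y \<in> carrier A; z \<in> carrier A\<rbrakk> \<Longrightarrow> x \<otimes> (y \<oplus> z) = x \<otimes> y \<oplus> x \<otimes> z"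
    and mult_smult_left:
      "\<lbrakk>x \<in> carrier A; y \<in> carrier A\<rbrakk> \<Longrightarrow> (c \<odot> x) \<otimes> y = c \<odot> (x \<otimes> y)"
    and mult_smult_right:
      "\<lbrakk>x \<in> carrier A; y \<in> carrier A\<rbrakk> \<Longrightarrow> x \<otimes> (c \<odot> y) = c \<odot> (x \<otimes> y)"

definition associator :: "('k, 'a, 'm) module_scheme \<Rightarrow> 'a \<Rightarrow> 'a \<Rightarrow> 'a \<Rightarrow> 'a" where
  "associator A x y z = ((x \<otimes>\<^bsub>A\<^esub> y) \<otimes>\<^bsub>A\<^esub> z) \<ominus>\<^bsub>A\<^esub> (x \<otimes>\<^bsub>A\<^esub> (y \<otimes>\<^bsub>A\<^esub> z))"

definition eps_bracket :: "('k, 'a, 'm) module_scheme \<Rightarrow> 'k \<Rightarrow> 'a \<Rightarrow> 'a \<Rightarrow> 'a" where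
  "eps_bracket A \<epsilon> x y = (x \<otimes>\<^bsub>A\<^esub> y) \<ominus>\<^bsub>A\<^esub> (\<epsilon> \<odot>\<^bsub>A\<^esub> (y \<otimes>\<^bsub>A\<^esub> x))"

definition V_eps :: "'k::field \<Rightarrow> ('k, 'a) module set" where
  "V_eps \<epsilon> = {A. nonassoc_algebra A \<and>
     (\<forall>x \<in> carrier A. \<forall>y \<in> carrier A. \<forall>z \<in> carrier A. \<forall>t \<in> carrier A.
        (x \<otimes>\<^bsub>A\<^esub> y) \<otimes>\<^bsub>A\<^esub> (z \<otimes>\<^bsub>A\<^esub> t) = \<zero>\<^bsub>A\<^esub>) \<and>
     (\<forall>x \<in> carrier A. \<forall>y \<in> carrier A. \<forall>z \<in> carrier A.
        associator A x y z = \<epsilon> \<odot>\<^bsub>A\<^esub> associator A x z y) \<and>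
     (\<forall>x \<in> carrier A. \<forall>y \<in> carrier A. \<forall>z \<in> carrier A.
        eps_bracket A \<epsilon> (eps_bracket A \<epsilon> x y) z = \<zero>\<^bsub>A\<^esub>)}"


section \<open>Superalgebras and the Grassmann envelope\<close>

record ('k, 'a) superalgebra = "('k, 'a) module" +
  part :: "bit \<Rightarrow> 'a set"

locale superalgebra = nonassoc_algebra A
  for A :: "('k::field, 'a, 'm) superalgebra_scheme" (structure) +
  assumes part_submodule: "submodule (part A i) (ring_of_type_algebra :: 'k::field ring) A"
    and part_disjoint: "part A 0 \<inter> part A 1 = {\<zero>}"
    and part_sum: "carrier A = part A 0 <+>\<^bsub>A\<^esub> part A 1"
    and part_mult: "\<lbrakk>x \<in> part A i; y \<in> part A j\<rbrakk> \<Longrightarrow> x \<otimes> y \<in> part A (i + j)"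

text \<open>
  The Grassmann algebra has the basis \<open>e\<^sub>S = e\<^sub>i\<^sub>1 \<dots> e\<^sub>i\<^sub>k\<close> for finite
  \<open>S = {i\<^sub>1 < \<dots> < i\<^sub>k} \<subseteq> \<nat>\<close>, with \<open>e\<^sub>S e\<^sub>T = grassmann_sign S T e\<^bsub>S \<union> T\<^esub>\<close> if \<open>S\<close> and \<open>T\<close> are
  disjoint and \<open>e\<^sub>S e\<^sub>T = 0\<close> otherwise. An element of the Grassmann envelope is written uniquely as
  \<open>\<Sum>\<^sub>S e\<^sub>S \<otimes> \<phi> S\<close>, with \<open>\<phi> S\<close> of the same parity as \<open>card S\<close>, and is represented by \<open>\<phi>\<close>.
\<close>

definition grassmann_sign :: "nat set \<Rightarrow> nat set \<Rightarrow> 'k::ring_1" where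
  "grassmann_sign S T = (- 1) ^ card {(i, j). i \<in> S \<and> j \<in> T \<and> j < i}"

definition grassmann_envelope ::
    "('k::field, 'a, 'm) superalgebra_scheme \<Rightarrow> ('k, nat set \<Rightarrow> 'a) module" where
  "grassmann_envelope A =
    \<lparr>carrier = {\<phi>. finite {S. \<phi> S \<noteq> \<zero>\<^bsub>A\<^esub>} \<and> (\<forall>S. infinite S \<longrightarrow> \<phi> S = \<zero>\<^bsub>A\<^esub>) \<and>
        (\<forall>S. finite S \<longrightarrow> \<phi> S \<in> part A (of_nat (card S)))},
     monoid.mult = (\<lambda>\<phi> \<psi> U. if finite U
        then \<Oplus>\<^bsub>A\<^esub>S \<in> Pow U. grassmann_sign S (U - S) \<odot>\<^bsub>A\<^esub> (\<phi> S \<otimes>\<^bsub>A\<^esub> \<psi> (U - S))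
        else \<zero>\<^bsub>A\<^esub>),
     one = (\<lambda>_. \<zero>\<^bsub>A\<^esub>),
     zero = (\<lambda>_. \<zero>\<^bsub>A\<^esub>),
     add = (\<lambda>\<phi> \<psi> U. \<phi> U \<oplus>\<^bsub>A\<^esub> \<psi> U),
     module.smult = (\<lambda>c \<phi> U. c \<odot>\<^bsub>A\<^esub> \<phi> U)\<rparr>"

definition super_class ::
    "('k::field, nat set \<Rightarrow> 'a) module set \<Rightarrow> ('k, 'a) superalgebra set" where
  "super_class \<V> = {A. superalgebra A \<and> grassmann_envelope A \<in> \<V>}"


section \<open>Nonassociative polynomials and superidentities\<close>

datatype 'x monomial = Var 'x | Prod "'x monomial" "'x monomial"

primrec letters :: "'x monomial \<Rightarrow> 'x list" where
  "letters (Var x) = [x]"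
| "letters (Prod u v) = letters u @ letters v"

text \<open>A nonassociative polynomial is its coefficient function \<open>'x monomial \<Rightarrow> 'k\<close>.\<close>

definition multilinear :: "nat \<Rightarrow> (nat monomial \<Rightarrow> 'k::field) \<Rightarrow> bool" where
  "multilinear n f \<longleftrightarrow> finite {w. f w \<noteq> 0} \<and>
     (\<forall>w. f w \<noteq> 0 \<longrightarrow> distinct (letters w) \<and> set (letters w) = {..<n})"

text \<open>
  The sign of the permutation that the odd variables of \<open>w\<close> undergo when the variables
  are brought from the order \<open>0, 1, 2, \<dots>\<close> into the order in which they occur in \<open>w\<close>.
\<close>

definition koszul_sign :: "(nat \<Rightarrow> bit) \<Rightarrow> nat monomial \<Rightarrow> 'k::ring_1" where
  "koszul_sign p w = (- 1) ^ card {(i, j). i < j \<and> j < length (letters w) \<and>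
     letters w ! j < letters w ! i \<and> p (letters w ! i) = 1 \<and> p (letters w ! j) = 1}"

definition superization ::
    "(nat \<Rightarrow> bit) \<Rightarrow> (nat monomial \<Rightarrow> 'k::field) \<Rightarrow> nat monomial \<Rightarrow> 'k" where
  "superization p f = (\<lambda>w. koszul_sign p w * f w)"

primrec eval_monomial :: "('a, 'm) ring_scheme \<Rightarrow> ('x \<Rightarrow> 'a) \<Rightarrow> 'x monomial \<Rightarrow> 'a" where
  "eval_monomial A a (Var x) = a x"
| "eval_monomial A a (Prod u v) = eval_monomial A a u \<otimes>\<^bsub>A\<^esub> eval_monomial A a v"

definition eval_poly ::
    "('k::field, 'a, 'm) module_scheme \<Rightarrow> ('x \<Rightarrow> 'a) \<Rightarrow> ('x monomial \<Rightarrow> 'k) \<Rightarrow> 'a" where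
  "eval_poly A a f = (\<Oplus>\<^bsub>A\<^esub>w \<in> {w. f w \<noteq> 0}. f w \<odot>\<^bsub>A\<^esub> eval_monomial A a w)"

definition satisfies_superidentity ::
    "('k::field, 'a, 'm) superalgebra_scheme \<Rightarrow> (nat monomial \<Rightarrow> 'k) \<Rightarrow> bool" where
  "satisfies_superidentity A f \<longleftrightarrow>
     (\<forall>p a. (\<forall>i. a i \<in> part A (p i)) \<longrightarrow> eval_poly A a (superization p f) = \<zero>\<^bsub>A\<^esub>)"

definition generated_supervariety ::
    "('k::field, 'b, 'm) superalgebra_scheme \<Rightarrow> ('k, 'a) superalgebra set" where
  "generated_supervariety B = {A. superalgebra A \<and>
     (\<forall>n f. multilinear n f \<longrightarrow> satisfies_superidentity B f \<longrightarrow> satisfies_superidentity A f)}"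


section \<open>Free superalgebras of a variety\<close>

definition free_nonassoc_superalgebra ::
    "'x set \<Rightarrow> ('x \<Rightarrow> bit) \<Rightarrow> ('k::field, 'x monomial \<Rightarrow> 'k) superalgebra" where
  "free_nonassoc_superalgebra I p =
    \<lparr>carrier = {f. finite {w. f w \<noteq> 0} \<and> (\<forall>w. f w \<noteq> 0 \<longrightarrow> set (letters w) \<subseteq> I)},
     monoid.mult = (\<lambda>f g w. case w of Var x \<Rightarrow> 0 | Prod u v \<Rightarrow> f u * g v),
     one = (\<lambda>_. 0),
     zero = (\<lambda>_. 0),
     add = (\<lambda>f g w. f w + g w),
     module.smult = (\<lambda>c f w. c * f w),
     part = (\<lambda>i. {f. finite {w. f w \<noteq> 0} \<and>
        (\<forall>w. f w \<noteq> 0 \<longrightarrow> set (letters w) \<subseteq> I \<and> sum_list (map p (letters w)) = i)})\<rparr>"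

definition graded_ideal :: "'a set \<Rightarrow> ('k::field, 'a, 'm) superalgebra_scheme \<Rightarrow> bool" where
  "graded_ideal J A \<longleftrightarrow> submodule J (ring_of_type_algebra :: 'k::field ring) A \<and>
     (\<forall>x \<in> carrier A. \<forall>y \<in> J. x \<otimes>\<^bsub>A\<^esub> y \<in> J \<and> y \<otimes>\<^bsub>A\<^esub> x \<in> J) \<and>
     J = (J \<inter> part A 0) <+>\<^bsub>A\<^esub> (J \<inter> part A 1)"

text \<open>
  The ring part is the record \<open>A Quot J\<close>. In the scalar multiplication the sum with \<open>J\<close> is needed
  for the scalar \<open>0\<close>, where the elementwise multiple of a coset is \<open>{0}\<close>.
\<close>

definition quotient_superalgebra ::
    "('k::field, 'a, 'm) superalgebra_scheme \<Rightarrow> 'a set \<Rightarrow> ('k, 'a set) superalgebra" where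
  "quotient_superalgebra A J =
    \<lparr>carrier = carrier (A Quot J),
     monoid.mult = monoid.mult (A Quot J),
     one = one (A Quot J),
     zero = zero (A Quot J),
     add = add (A Quot J),
     module.smult = (\<lambda>c C. \<Union>x \<in> C. J +>\<^bsub>A\<^esub> (c \<odot>\<^bsub>A\<^esub> x)),
     part = (\<lambda>i. {J +>\<^bsub>A\<^esub> x | x. x \<in> part A i})\<rparr>"

text \<open>
  The free superalgebra of the variety \<open>\<V>\<close> on the generators \<open>I\<close> with parities \<open>p\<close>: the quotient
  of the free nonassociative superalgebra by its least graded ideal with quotient in the class.
\<close>

definition free_superalgebra ::
    "('k::field, nat set \<Rightarrow> ('x monomial \<Rightarrow> 'k) set) module set \<Rightarrow> 'x set \<Rightarrow> ('x \<Rightarrow> bit) \<Rightarrow>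
     ('k, ('x monomial \<Rightarrow> 'k) set) superalgebra" where
  "free_superalgebra \<V> I p =
     (let F = free_nonassoc_superalgebra I p
      in quotient_superalgebra F
           (\<Inter> {J. graded_ideal J F \<and> quotient_superalgebra F J \<in> super_class \<V>}))"

text \<open>The generators are \<open>0, \<dots>, r + s - 1\<close>, of which the first \<open>r\<close> are even and the rest odd.\<close>

definition rank_supervariety ::
    "('k::field, nat set \<Rightarrow> (nat monomial \<Rightarrow> 'k) set) module set \<Rightarrow> nat \<Rightarrow> nat \<Rightarrow>
     ('k, 'a) superalgebra set" where
  "rank_supervariety \<V> r s =
     (if r = 0 \<and> s = 0 then {A. superalgebra A \<and> carrier A = {\<zero>\<^bsub>A\<^esub>}}
      else generated_supervariety
             (free_superalgebra \<V> {..<r + s} (\<lambda>i. if i < r then 0 else 1)))"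

text \<open>
  Classes of superalgebras are compared on superalgebras whose carrier is a set of elements of the
  following type. It contains every quotient of the free nonassociative superalgebra on countably
  many even and countably many odd generators, hence a copy of every countably generated
  superalgebra; in particular it contains the free superalgebras of every variety on countably
  many generators.
\<close>

type_synonym 'k univ = "(nat monomial \<Rightarrow> 'k) set"

end

theory Submission
  imports Defs "HOL-Library.Function_Algebras"
begin

text \<open>
The proof compares the growth of the multilinear components of two objects.

Write \<open>R\<^sub>y\<close> and \<open>L\<^sub>y\<close> for right and left multiplication by \<open>y\<close>, acting on \<open>A\<^sup>2\<close> for an algebra \<open>A\<close>
of the variety, with operators composed from left to right, and put \<open>T\<^sub>y = R\<^sub>y - \<epsilon> L\<^sub>y\<close>. As
\<open>A\<^sup>2 A\<^sup>2 = 0\<close>, the three identities become \<open>R\<^sub>y R\<^sub>z = \<epsilon> R\<^sub>z R\<^sub>y\<close>, \<open>T\<^sub>y T\<^sub>z = 0\<close> and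
\<open>R\<^sub>y R\<^sub>z = T\<^sub>y R\<^sub>z + T\<^sub>z R\<^sub>y\<close> on \<open>A\<^sup>2\<close>. They tie the two letters inside one factor \<open>T\<^sub>y R\<^sub>z\<close>
together, but in a product of such factors the letters \<open>y\<close> of different factors stay unrelated.
Hence the \<open>n!\<close> words \<open>(y\<^sub>\<sigma>\<^sub>(\<^sub>0\<^sub>) (\<dots> (y\<^sub>\<sigma>\<^sub>(\<^sub>n\<^sub>-\<^sub>1\<^sub>) (x\<^sub>0 x\<^sub>1)) z\<^sub>0 \<dots>)) z\<^sub>n\<^sub>-\<^sub>1\<close>, called \<open>nested_word\<close>
below, are linearly independent modulo the identities of the variety. This is seen in an explicit
algebra, \<open>model_superalgebra\<close>, in which for each \<open>\<sigma>\<close> some substitution sends the word of \<open>\<sigma>\<close> to a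
nonzero vector and the words of all other permutations to zero (\<open>word_poly_not_superidentity\<close>).
It is purely even, so its Grassmann envelope is an extension by the commutative algebra \<open>G\<^sub>0\<close> and
inherits the multilinear identities (\<open>even_superalgebra_in_super_class\<close>).

In the free superalgebra on \<open>d = r + s\<close> generators only metabelianity matters: since
\<open>A\<^sup>2 A\<^sup>2 = 0\<close>, a nested word depends only on the parts of the arguments for \<open>y\<^sub>i\<close>, \<open>z\<^sub>i\<close> that are
linear in the generators. So the value of \<open>\<Sum>\<^sub>\<sigma> c\<^sub>\<sigma> w\<^sub>\<sigma>\<close>, with Koszul signs, vanishes for all
arguments as soon as one linear equation in \<open>c\<close> holds for every choice of the parities of the
\<open>2 n + 2\<close> variables, of a generator for every variable \<open>y\<^sub>i\<close> and of a generator for every position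
of such a variable (\<open>ordering_product_sum_zero\<close>). These are \<open>2\<^sup>2\<^sup>n\<^sup>+\<^sup>2 d\<^sup>2\<^sup>n\<close> equations in \<open>n!\<close> unknowns,
and \<open>n!\<close> wins for large \<open>n\<close>, so there is a nonzero solution (\<open>exists_vanishing_coefficients\<close>).
The resulting multilinear polynomial is a superidentity of the free superalgebra on \<open>d\<close>
generators (\<open>free_superalgebra_satisfies_superidentity\<close>) and fails in the model.
\<close>

section \<open>Record algebras as images of algebras on types\<close>

text \<open>
The three defining identities of the variety, for a product \<open>mul\<close> on a subset \<open>C\<close> of a type with
its own addition and scalar multiplication.
\<close>

definition satisfies_V_eps ::
    "('k::field \<Rightarrow> 'b::ab_group_add \<Rightarrow> 'b) \<Rightarrow> 'b set \<Rightarrow> ('b \<Rightarrow> 'b \<Rightarrow> 'b) \<Rightarrow> 'k \<Rightarrow> bool" where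
  "satisfies_V_eps scale C mul \<epsilon> \<longleftrightarrow>
    (\<forall>x\<in>C. \<forall>y\<in>C. \<forall>z\<in>C. \<forall>t\<in>C. mul (mul x y) (mul z t) = 0) \<and>
    (\<forall>x\<in>C. \<forall>y\<in>C. \<forall>z\<in>C. mul (mul x y) z - mul x (mul y z)
        = scale \<epsilon> (mul (mul x z) y - mul x (mul z y))) \<and>
    (\<forall>x\<in>C. \<forall>y\<in>C. \<forall>z\<in>C.
        mul (mul x y - scale \<epsilon> (mul y x)) z
          - scale \<epsilon> (mul z (mul x y - scale \<epsilon> (mul y x))) = 0)"

primrec monomial_value :: "('b \<Rightarrow> 'b \<Rightarrow> 'b) \<Rightarrow> ('x \<Rightarrow> 'b) \<Rightarrow> 'x monomial \<Rightarrow> 'b" where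
  "monomial_value mul a (Var x) = a x"
| "monomial_value mul a (Prod u v) = mul (monomial_value mul a u) (monomial_value mul a v)"

text \<open>
Calculations with record algebras are carried out in types whose addition belongs to a type class,
and transported along a surjection \<open>H\<close>. As \<open>H\<close> may identify elements, the locale covers both
isomorphic copies and quotients by ideals.
\<close>

locale algebra_image = vector_space scale
  for scale :: "'k::field \<Rightarrow> 'b::ab_group_add \<Rightarrow> 'b" +
  fixes C :: "'b set" and mul :: "'b \<Rightarrow> 'b \<Rightarrow> 'b" and H :: "'b \<Rightarrow> 'a"
    and A :: "('k, 'a, 'm) module_scheme"
  assumes zero_C: "0 \<in> C"
    and add_C: "\<lbrakk>x \<in> C; y \<in> C\<rbrakk> \<Longrightarrow> x + y \<in> C"
    and scale_C: "x \<in> C \<Longrightarrow> scale c x \<in> C"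
    and mul_C: "\<lbrakk>x \<in> C; y \<in> C\<rbrakk> \<Longrightarrow> mul x y \<in> C"
    and mul_add_left: "\<lbrakk>x \<in> C; y \<in> C; z \<in> C\<rbrakk> \<Longrightarrow> mul (x + y) z = mul x z + mul y z"
    and mul_add_right: "\<lbrakk>x \<in> C; y \<in> C; z \<in> C\<rbrakk> \<Longrightarrow> mul x (y + z) = mul x y + mul x z"
    and mul_scale_left: "\<lbrakk>x \<in> C; y \<in> C\<rbrakk> \<Longrightarrow> mul (scale c x) y = scale c (mul x y)"
    and mul_scale_right: "\<lbrakk>x \<in> C; y \<in> C\<rbrakk> \<Longrightarrow> mul x (scale c y) = scale c (mul x y)"
    and carrier_A: "carrier A = H ` C"
    and zero_A: "\<zero>\<^bsub>A\<^esub> = H 0"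
    and add_A: "\<lbrakk>x \<in> C; y \<in> C\<rbrakk> \<Longrightarrow> H x \<oplus>\<^bsub>A\<^esub> H y = H (x + y)"
    and smult_A: "x \<in> C \<Longrightarrow> c \<odot>\<^bsub>A\<^esub> H x = H (scale c x)"
    and mult_A: "\<lbrakk>x \<in> C; y \<in> C\<rbrakk> \<Longrightarrow> H x \<otimes>\<^bsub>A\<^esub> H y = H (mul x y)"
begin

lemma uminus_C: "x \<in> C \<Longrightarrow> - x \<in> C"
  using scale_C[of x "- 1"] by simp

lemma diff_C: "\<lbrakk>x \<in> C; y \<in> C\<rbrakk> \<Longrightarrow> x - y \<in> C"
  using add_C[of x "- y"] uminus_C[of y] by simp

lemma sum_C: "(\<And>i. i \<in> I \<Longrightarrow> t i \<in> C) \<Longrightarrow> sum t I \<in> C"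
  by (induction I rule: infinite_finite_induct) (simp_all add: zero_C add_C)

lemma H_carrier: "x \<in> C \<Longrightarrow> H x \<in> carrier A"
  by (simp add: carrier_A)

lemma abelian_group_A: "abelian_group A"
proof (rule abelian_groupI)
  fix x assume "x \<in> carrier A"
  then obtain u where u: "u \<in> C" "x = H u" by (auto simp: carrier_A)
  then have "H (- u) \<oplus>\<^bsub>A\<^esub> x = \<zero>\<^bsub>A\<^esub>" by (simp add: add_A uminus_C zero_A)
  then show "\<exists>y\<in>carrier A. y \<oplus>\<^bsub>A\<^esub> x = \<zero>\<^bsub>A\<^esub>"
    using u uminus_C H_carrier by blast
qed (auto simp: carrier_A zero_A zero_C add_C add_A algebra_simps)

sublocale A: abelian_group A
  by (rule abelian_group_A)

lemma nonassoc_algebra_A: "nonassoc_algebra A"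
proof (intro nonassoc_algebra.intro nonassoc_algebra_axioms.intro moduleI)
  show "cring (ring_of_type_algebra :: 'k ring)" by (rule cring_from_type_algebra)
qed (auto simp: ring_of_type_algebra_def carrier_A zero_A zero_C add_C add_A scale_C smult_A mul_C
    mult_A mul_add_left mul_add_right mul_scale_left mul_scale_right
    scale_left_distrib scale_right_distrib intro: abelian_group_A)

lemma minus_A: "\<lbrakk>x \<in> C; y \<in> C\<rbrakk> \<Longrightarrow> H x \<ominus>\<^bsub>A\<^esub> H y = H (x - y)"
proof -
  assume xy: "x \<in> C" "y \<in> C"
  have "\<ominus>\<^bsub>A\<^esub> H y = H (- y)"
    by (rule A.minus_equality) (simp_all add: xy uminus_C H_carrier add_A zero_A)
  then show ?thesis by (simp add: A.minus_eq xy uminus_C add_A)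
qed

lemma finsum_A: "(\<And>i. i \<in> I \<Longrightarrow> t i \<in> C) \<Longrightarrow> finsum A (\<lambda>i. H (t i)) I = H (sum t I)"
proof (induction I rule: infinite_finite_induct)
  case (insert i I)
  then have "finsum A (\<lambda>i. H (t i)) (insert i I) = H (t i) \<oplus>\<^bsub>A\<^esub> finsum A (\<lambda>i. H (t i)) I"
    by (intro A.finsum_insert) (auto intro: H_carrier)
  then show ?case using insert by (simp add: add_A sum_C)
qed (simp_all add: zero_A A.finsum_infinite)

lemma monomial_value_C: "(\<And>x. a x \<in> C) \<Longrightarrow> monomial_value mul a w \<in> C"
  by (induction w) (simp_all add: mul_C)

lemma eval_monomial_A:
  "(\<And>x. a x \<in> C) \<Longrightarrow> eval_monomial A (\<lambda>x. H (a x)) w = H (monomial_value mul a w)"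
  by (induction w) (simp_all add: mult_A monomial_value_C)

lemma eval_poly_A:
  assumes "\<And>x. a x \<in> C"
  shows "eval_poly A (\<lambda>x. H (a x)) f
    = H (\<Sum>w | f w \<noteq> 0. scale (f w) (monomial_value mul a w))"
  unfolding eval_poly_def eval_monomial_A[OF assms]
  by (simp add: smult_A monomial_value_C assms finsum_A scale_C)

lemma associator_A:
  "\<lbrakk>x \<in> C; y \<in> C; z \<in> C\<rbrakk>
    \<Longrightarrow> associator A (H x) (H y) (H z) = H (mul (mul x y) z - mul x (mul y z))"
  by (simp add: associator_def mult_A mul_C minus_A)

lemma eps_bracket_A:
  "\<lbrakk>x \<in> C; y \<in> C\<rbrakk> \<Longrightarrow> eps_bracket A \<epsilon> (H x) (H y) = H (mul x y - scale \<epsilon> (mul y x))"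
  by (simp add: eps_bracket_def mult_A mul_C minus_A smult_A scale_C)

end

lemma image_in_V_eps:
  fixes A :: "('k::field, 'a) module"
  assumes "algebra_image scale C mul H A" "satisfies_V_eps scale C mul \<epsilon>"
  shows "A \<in> V_eps \<epsilon>"
proof -
  interpret algebra_image scale C mul H A by fact
  have m: "mul (mul x y) (mul z t) = 0" if "x \<in> C" "y \<in> C" "z \<in> C" "t \<in> C" for x y z t
    using assms(2) that unfolding satisfies_V_eps_def by blast
  have a: "mul (mul x y) z - mul x (mul y z) = scale \<epsilon> (mul (mul x z) y - mul x (mul z y))"
    if "x \<in> C" "y \<in> C" "z \<in> C" for x y z
    using assms(2) that unfolding satisfies_V_eps_def by blast
  have b: "mul (mul x y - scale \<epsilon> (mul y x)) z
      - scale \<epsilon> (mul z (mul x y - scale \<epsilon> (mul y x))) = 0"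
    if "x \<in> C" "y \<in> C" "z \<in> C" for x y z
    using assms(2) that unfolding satisfies_V_eps_def by blast
  show ?thesis
    unfolding V_eps_def carrier_A mem_Collect_eq ball_simps
  proof (intro conjI ballI nonassoc_algebra_A)
    fix x y z t assume "x \<in> C" "y \<in> C" "z \<in> C" "t \<in> C"
    then show "H x \<otimes>\<^bsub>A\<^esub> H y \<otimes>\<^bsub>A\<^esub> (H z \<otimes>\<^bsub>A\<^esub> H t) = \<zero>\<^bsub>A\<^esub>"
      by (simp only: mult_A mul_C m zero_A)
  next
    fix x y z assume "x \<in> C" "y \<in> C" "z \<in> C"
    then show "associator A (H x) (H y) (H z) = \<epsilon> \<odot>\<^bsub>A\<^esub> associator A (H x) (H z) (H y)"
      using a[of x y z] by (simp only: associator_A smult_A mul_C diff_C)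
  next
    fix x y z assume "x \<in> C" "y \<in> C" "z \<in> C"
    then show "eps_bracket A \<epsilon> (eps_bracket A \<epsilon> (H x) (H y)) (H z) = \<zero>\<^bsub>A\<^esub>"
      by (simp only: eps_bracket_A b zero_A mul_C diff_C scale_C)
  qed
qed

section \<open>Grassmann envelopes of even algebras\<close>

lemma grassmann_sign_cases: "grassmann_sign S T = (1 :: 'k::ring_1) \<or> grassmann_sign S T = (- 1 :: 'k)"
  by (simp add: grassmann_sign_def minus_one_power_iff)

lemma finite_inversions: "finite S \<Longrightarrow> finite T \<Longrightarrow> finite {(i, j). i \<in> S \<and> j \<in> T \<and> j < (i :: nat)}"
  by (rule finite_subset[of _ "S \<times> T"]) auto

lemma grassmann_sign_Un_left:
  assumes "finite S" "finite S'" "finite T" "S \<inter> S' = {}"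
  shows "grassmann_sign (S \<union> S') T = (grassmann_sign S T * grassmann_sign S' T :: 'k::ring_1)"
proof -
  have "{(i, j). i \<in> S \<union> S' \<and> j \<in> T \<and> j < i}
      = {(i, j). i \<in> S \<and> j \<in> T \<and> j < i} \<union> {(i, j). i \<in> S' \<and> j \<in> T \<and> j < i}" by auto
  then have "card {(i, j). i \<in> S \<union> S' \<and> j \<in> T \<and> j < i}
      = card {(i, j). i \<in> S \<and> j \<in> T \<and> j < i} + card {(i, j). i \<in> S' \<and> j \<in> T \<and> j < i}"
    using assms by (simp add: card_Un_disjoint finite_inversions disjoint_iff)
  then show ?thesis by (simp add: grassmann_sign_def power_add)
qed

lemma grassmann_sign_Un_right:
  assumes "finite S" "finite T" "finite T'" "T \<inter> T' = {}"
  shows "grassmann_sign S (T \<union> T') = (grassmann_sign S T * grassmann_sign S T' :: 'k::ring_1)"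
proof -
  have "{(i, j). i \<in> S \<and> j \<in> T \<union> T' \<and> j < i}
      = {(i, j). i \<in> S \<and> j \<in> T \<and> j < i} \<union> {(i, j). i \<in> S \<and> j \<in> T' \<and> j < i}" by auto
  then have "card {(i, j). i \<in> S \<and> j \<in> T \<union> T' \<and> j < i}
      = card {(i, j). i \<in> S \<and> j \<in> T \<and> j < i} + card {(i, j). i \<in> S \<and> j \<in> T' \<and> j < i}"
    using assms by (simp add: card_Un_disjoint finite_inversions disjoint_iff)
  then show ?thesis by (simp add: grassmann_sign_def power_add)
qed

text \<open>
Each pair in \<open>S \<times> T\<close> is an inversion of exactly one of \<open>e\<^sub>S e\<^sub>T\<close> and \<open>e\<^sub>T e\<^sub>S\<close>, so the two inversion
numbers add up to the even number \<open>card S * card T\<close>.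
\<close>

lemma grassmann_sign_commute:
  assumes "finite S" "finite T" "S \<inter> T = {}" "even (card S) \<or> even (card T)"
  shows "grassmann_sign S T = (grassmann_sign T S :: 'k::comm_ring_1)"
proof -
  let ?I = "{(i, j). i \<in> S \<and> j \<in> T \<and> j < i}" and ?J = "{(i, j). i \<in> T \<and> j \<in> S \<and> j < i}"
  have "S \<times> T = ?I \<union> prod.swap ` ?J" using assms(3) by (auto simp: image_iff)
  moreover have "?I \<inter> prod.swap ` ?J = {}" by auto
  ultimately have "card (S \<times> T) = card ?I + card (prod.swap ` ?J)"
    using assms by (simp add: card_Un_disjoint finite_inversions)
  also have "card (prod.swap ` ?J) = card ?J" by (intro card_image) simp
  finally have "card S * card T = card ?I + card ?J" by (simp only: card_cartesian_product)
  then have "even (card ?I + card ?J)" using assms(4) by (metis even_mult_iff)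
  then show ?thesis by (simp add: grassmann_sign_def minus_one_power_iff)
qed

definition three_parts :: "'x set \<Rightarrow> ('x set \<times> 'x set \<times> 'x set) set" where
  "three_parts U = {(S, T, R). S \<inter> T = {} \<and> S \<inter> R = {} \<and> T \<inter> R = {} \<and> S \<union> T \<union> R = U}"

text \<open>
The sign in \<open>e\<^sub>S e\<^sub>T e\<^sub>R = sign3 S T R e\<^bsub>S \<union> T \<union> R\<^esub>\<close>, which does not depend on the bracketing.
\<close>

definition sign3 :: "nat set \<Rightarrow> nat set \<Rightarrow> nat set \<Rightarrow> 'k::comm_ring_1" where
  "sign3 S T R = grassmann_sign S T * grassmann_sign S R * grassmann_sign T R"

context algebra_image
begin

text \<open>
The product of \<open>grassmann_envelope\<close>, and the carrier of \<open>G\<^sub>0 \<otimes> C\<close>, on functions into the type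
of \<open>C\<close>.
\<close>

definition envelope_mul :: "(nat set \<Rightarrow> 'b) \<Rightarrow> (nat set \<Rightarrow> 'b) \<Rightarrow> nat set \<Rightarrow> 'b" where
  "envelope_mul \<phi> \<psi> U = (if finite U
     then \<Sum>S\<in>Pow U. scale (grassmann_sign S (U - S)) (mul (\<phi> S) (\<psi> (U - S))) else 0)"

definition even_envelope :: "(nat set \<Rightarrow> 'b) set" where
  "even_envelope = {\<phi>. finite {S. \<phi> S \<noteq> 0} \<and> (\<forall>S. \<phi> S \<in> C)
     \<and> (\<forall>S. infinite S \<or> odd (card S) \<longrightarrow> \<phi> S = 0)}"

lemma mul_zero: "x \<in> C \<Longrightarrow> mul 0 x = 0" "x \<in> C \<Longrightarrow> mul x 0 = 0"
  using mul_scale_left[of 0 x 0] mul_scale_right[of x 0 0] zero_C by simp_all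

lemma mul_diff_left: "\<lbrakk>x \<in> C; y \<in> C; z \<in> C\<rbrakk> \<Longrightarrow> mul (x - y) z = mul x z - mul y z"
  using mul_add_left[of "x - y" y z] by (simp add: diff_C)

lemma mul_diff_right: "\<lbrakk>x \<in> C; y \<in> C; z \<in> C\<rbrakk> \<Longrightarrow> mul z (x - y) = mul z x - mul z y"
  using mul_add_right[of z "x - y" y] by (simp add: diff_C)

lemma mul_sum_left: "(\<And>i. i \<in> I \<Longrightarrow> t i \<in> C) \<Longrightarrow> x \<in> C \<Longrightarrow> mul (sum t I) x = (\<Sum>i\<in>I. mul (t i) x)"
  by (induction I rule: infinite_finite_induct) (simp_all add: mul_zero mul_add_left sum_C)

lemma mul_sum_right: "(\<And>i. i \<in> I \<Longrightarrow> t i \<in> C) \<Longrightarrow> x \<in> C \<Longrightarrow> mul x (sum t I) = (\<Sum>i\<in>I. mul x (t i))"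
  by (induction I rule: infinite_finite_induct) (simp_all add: mul_zero mul_add_right sum_C)

lemma envelope_C: "\<phi> \<in> even_envelope \<Longrightarrow> \<phi> S \<in> C"
  by (simp add: even_envelope_def)

text \<open>
Both bracketings of a triple product expand into one sum over the ordered partitions of \<open>U\<close> into
three parts, with the same sign. After this an identity of degree three can be compared
partition by partition.
\<close>

lemma envelope_mul_left:
  assumes "\<And>S. \<phi> S \<in> C" "\<And>S. \<psi> S \<in> C" "\<And>S. \<chi> S \<in> C" "finite U"
  shows "envelope_mul (envelope_mul \<phi> \<psi>) \<chi> U
    = (\<Sum>(S, T, R)\<in>three_parts U. scale (sign3 S T R) (mul (mul (\<phi> S) (\<psi> T)) (\<chi> R)))"
proof -
  have "envelope_mul (envelope_mul \<phi> \<psi>) \<chi> U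
      = (\<Sum>P\<in>Pow U. \<Sum>S\<in>Pow P. scale (grassmann_sign P (U - P) * grassmann_sign S (P - S))
          (mul (mul (\<phi> S) (\<psi> (P - S))) (\<chi> (U - P))))"
    using assms finite_subset[of _ U]
    by (auto simp: envelope_mul_def mul_sum_left scale_C mul_C mul_scale_left scale_sum_right
        intro!: sum.cong)
  also have "\<dots> = (\<Sum>(P, S)\<in>(SIGMA P:Pow U. Pow P). scale (grassmann_sign P (U - P) * grassmann_sign S (P - S))
          (mul (mul (\<phi> S) (\<psi> (P - S))) (\<chi> (U - P))))"
    using assms(4) finite_subset[of _ U] by (subst sum.Sigma) auto
  also have "\<dots> = (\<Sum>(S, T, R)\<in>three_parts U. scale (sign3 S T R) (mul (mul (\<phi> S) (\<psi> T)) (\<chi> R)))"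
  proof (rule sum.reindex_bij_witness[where i = "\<lambda>(S, T, R). (S \<union> T, S)"
        and j = "\<lambda>(P, S). (S, P - S, U - P)"], goal_cases)
    case (5 a)
    then obtain P S where a: "a = (P, S)" "S \<subseteq> P" "P \<subseteq> U" by auto
    then have f: "finite P" "finite S" using assms(4) by (auto intro: finite_subset)
    have "grassmann_sign P (U - P) = (grassmann_sign S (U - P) * grassmann_sign (P - S) (U - P) :: 'k)"
      using grassmann_sign_Un_left[of S "P - S" "U - P"] a f assms(4) by (simp add: Un_absorb1)
    then show ?case by (simp add: a sign3_def mult_ac)
  qed (auto simp: three_parts_def)
  finally show ?thesis .
qed

lemma envelope_mul_right:
  assumes "\<And>S. \<phi> S \<in> C" "\<And>S. \<psi> S \<in> C" "\<And>S. \<chi> S \<in> C" "finite U"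
  shows "envelope_mul \<phi> (envelope_mul \<psi> \<chi>) U
    = (\<Sum>(S, T, R)\<in>three_parts U. scale (sign3 S T R) (mul (\<phi> S) (mul (\<psi> T) (\<chi> R))))"
proof -
  have "envelope_mul \<phi> (envelope_mul \<psi> \<chi>) U
      = (\<Sum>S\<in>Pow U. \<Sum>T\<in>Pow (U - S). scale (grassmann_sign S (U - S) * grassmann_sign T (U - S - T))
          (mul (\<phi> S) (mul (\<psi> T) (\<chi> (U - S - T)))))"
    using assms finite_subset[of _ U]
    by (auto simp: envelope_mul_def mul_sum_right scale_C mul_C mul_scale_right scale_sum_right
        intro!: sum.cong)
  also have "\<dots> = (\<Sum>(S, T)\<in>(SIGMA S:Pow U. Pow (U - S)). scale (grassmann_sign S (U - S) * grassmann_sign T (U - S - T))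
          (mul (\<phi> S) (mul (\<psi> T) (\<chi> (U - S - T)))))"
    using assms(4) finite_subset[of _ U] by (subst sum.Sigma) auto
  also have "\<dots> = (\<Sum>(S, T, R)\<in>three_parts U. scale (sign3 S T R) (mul (\<phi> S) (mul (\<psi> T) (\<chi> R))))"
  proof (rule sum.reindex_bij_witness[where i = "\<lambda>(S, T, R). (S, T)"
        and j = "\<lambda>(S, T). (S, T, U - S - T)"], goal_cases)
    case (5 a)
    then obtain S T where a: "a = (S, T)" "S \<subseteq> U" "T \<subseteq> U - S" by auto
    then have f: "finite S" "finite T" using assms(4) by (auto intro: finite_subset)
    have "grassmann_sign S (U - S) = (grassmann_sign S T * grassmann_sign S (U - S - T) :: 'k)"
      using grassmann_sign_Un_right[of S T "U - S - T"] a f assms(4) by (simp add: Un_absorb1)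
    then show ?case by (simp add: a sign3_def mult_ac)
  qed (auto simp: three_parts_def)
  finally show ?thesis .
qed

definition three_sum :: "('b \<Rightarrow> 'b \<Rightarrow> 'b \<Rightarrow> 'b) \<Rightarrow> (nat set \<Rightarrow> 'b) \<Rightarrow> (nat set \<Rightarrow> 'b) \<Rightarrow> (nat set \<Rightarrow> 'b)
    \<Rightarrow> nat set \<Rightarrow> 'b" where
  "three_sum t \<phi> \<psi> \<chi> U =
    (\<Sum>(S, T, R)\<in>three_parts U. scale (sign3 S T R) (t (\<phi> S) (\<psi> T) (\<chi> R)))"

lemma even_envelope_even: "\<lbrakk>\<phi> \<in> even_envelope; \<phi> S \<noteq> 0\<rbrakk> \<Longrightarrow> even (card S)"
  by (auto simp: even_envelope_def)

text \<open>
The factors of a triple sum may be permuted because elements of \<open>G\<^sub>0\<close> commute: where a sign could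
change, both index sets are odd and the summand vanishes.
\<close>

lemma three_sum_swap_left:
  assumes "finite U" "\<phi> \<in> even_envelope" "\<psi> \<in> even_envelope" "\<chi> \<in> even_envelope"
    and "\<And>y z. \<lbrakk>y \<in> C; z \<in> C\<rbrakk> \<Longrightarrow> t 0 y z = 0"
  shows "three_sum t \<phi> \<psi> \<chi> U = three_sum (\<lambda>x y z. t y x z) \<psi> \<phi> \<chi> U"
  unfolding three_sum_def
proof (rule sum.reindex_bij_witness[where i = "\<lambda>(S, T, R). (T, S, R)" and j = "\<lambda>(S, T, R). (T, S, R)"],
    goal_cases)
  case (5 a)
  then obtain S T R where a: "a = (S, T, R)" "(S, T, R) \<in> three_parts U" by (cases a) auto
  then have f: "finite S" "finite T" "S \<inter> T = {}"
    using assms(1) by (auto simp: three_parts_def)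
  show ?case
  proof (cases "\<phi> S = 0")
    case False
    then have "grassmann_sign S T = (grassmann_sign T S :: 'k)"
      using f even_envelope_even[OF assms(2)] by (intro grassmann_sign_commute) auto
    then show ?thesis by (simp add: a sign3_def mult_ac)
  qed (simp add: a assms envelope_C)
qed (auto simp: three_parts_def)

lemma three_sum_swap_right:
  assumes "finite U" "\<phi> \<in> even_envelope" "\<psi> \<in> even_envelope" "\<chi> \<in> even_envelope"
    and "\<And>x z. \<lbrakk>x \<in> C; z \<in> C\<rbrakk> \<Longrightarrow> t x 0 z = 0"
  shows "three_sum t \<phi> \<psi> \<chi> U = three_sum (\<lambda>x y z. t x z y) \<phi> \<chi> \<psi> U"
  unfolding three_sum_def
proof (rule sum.reindex_bij_witness[where i = "\<lambda>(S, T, R). (S, R, T)" and j = "\<lambda>(S, T, R). (S, R, T)"],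
    goal_cases)
  case (5 a)
  then obtain S T R where a: "a = (S, T, R)" "(S, T, R) \<in> three_parts U" by (cases a) auto
  then have f: "finite T" "finite R" "T \<inter> R = {}"
    using assms(1) by (auto simp: three_parts_def)
  show ?case
  proof (cases "\<psi> T = 0")
    case False
    then have "grassmann_sign T R = (grassmann_sign R T :: 'k)"
      using f even_envelope_even[OF assms(3)] by (intro grassmann_sign_commute) auto
    then show ?thesis by (simp add: a sign3_def mult_ac)
  qed (simp add: a assms envelope_C)
qed (auto simp: three_parts_def)

lemma envelope_mul_nonzero:
  assumes "\<phi> \<in> even_envelope" "\<psi> \<in> even_envelope" "envelope_mul \<phi> \<psi> U \<noteq> 0"
  obtains S where "S \<subseteq> U" "\<phi> S \<noteq> 0" "\<psi> (U - S) \<noteq> 0"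
proof (rule ccontr)
  note witness = that
  assume "\<not> thesis"
  then have "mul (\<phi> S) (\<psi> (U - S)) = 0" if "S \<in> Pow U" for S
    using that witness[of S] mul_zero(1)[OF envelope_C[OF assms(2), of "U - S"]]
      mul_zero(2)[OF envelope_C[OF assms(1), of S]] by fastforce
  then show False using assms(3) by (auto simp: envelope_mul_def split: if_splits)
qed

text \<open>
A nonzero coefficient at \<open>U\<close> comes from a splitting of \<open>U\<close> into members of the two supports; so
the support is finite, and \<open>U\<close> is even as a union of two disjoint even sets.
\<close>

lemma envelope_mul_closed:
  assumes \<phi>: "\<phi> \<in> even_envelope" and \<psi>: "\<psi> \<in> even_envelope"
  shows "envelope_mul \<phi> \<psi> \<in> even_envelope"
proof -
  have "{U. envelope_mul \<phi> \<psi> U \<noteq> 0} \<subseteq> (\<lambda>(S, T). S \<union> T) ` ({S. \<phi> S \<noteq> 0} \<times> {T. \<psi> T \<noteq> 0})"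
  proof
    fix U assume "U \<in> {U. envelope_mul \<phi> \<psi> U \<noteq> 0}"
    then obtain S where S: "S \<subseteq> U" "\<phi> S \<noteq> 0" "\<psi> (U - S) \<noteq> 0"
      using envelope_mul_nonzero[OF \<phi> \<psi>] by blast
    then have "U = (\<lambda>(S, T). S \<union> T) (S, U - S)" by auto
    then show "U \<in> (\<lambda>(S, T). S \<union> T) ` ({S. \<phi> S \<noteq> 0} \<times> {T. \<psi> T \<noteq> 0})"
      using S by blast
  qed
  then have "finite {U. envelope_mul \<phi> \<psi> U \<noteq> 0}"
    by (rule finite_subset) (use assms in \<open>simp add: even_envelope_def\<close>)
  moreover have "envelope_mul \<phi> \<psi> U = 0" if U: "infinite U \<or> odd (card U)" for U
  proof (rule ccontr)
    assume nz: "envelope_mul \<phi> \<psi> U \<noteq> 0"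
    then obtain S where S: "S \<subseteq> U" "\<phi> S \<noteq> 0" "\<psi> (U - S) \<noteq> 0"
      using envelope_mul_nonzero[OF \<phi> \<psi>] by blast
    have fin: "finite U" using nz unfolding envelope_mul_def by presburger
    then have "card U = card S + card (U - S)"
      using S(1) by (metis card_Diff_subset card_mono finite_subset le_add_diff_inverse)
    moreover have "even (card S)" "even (card (U - S))"
      using even_envelope_even[OF \<phi> S(2)] even_envelope_even[OF \<psi> S(3)] .
    ultimately show False using U fin by simp
  qed
  moreover have "envelope_mul \<phi> \<psi> U \<in> C" for U
    unfolding envelope_mul_def using assms
    by (simp add: envelope_C zero_C sum_C scale_C mul_C)
  ultimately show ?thesis unfolding even_envelope_def by blast
qed

end

lemma bit_cases: "(i :: bit) = 0 \<or> i = 1"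
  by (cases i) auto

lemma of_nat_bit: "of_nat n = (if even n then 0 else 1 :: bit)"
  by (induction n) auto

text \<open>
A superalgebra without odd part. Injectivity of \<open>H\<close> lets the supports of the elements of the
Grassmann envelope be read off before applying \<open>H\<close>.
\<close>

locale even_superalgebra_image = algebra_image scale C mul H A
  for scale :: "'k::field \<Rightarrow> 'b::ab_group_add \<Rightarrow> 'b" and C mul and H :: "'b \<Rightarrow> 'a"
    and A :: "('k, 'a, 'm) superalgebra_scheme" +
  assumes inj_H: "inj_on H C"
    and part_0: "part A 0 = carrier A"
    and part_1: "part A 1 = {\<zero>\<^bsub>A\<^esub>}"
begin

lemma algebra_image_envelope:
  "algebra_image (\<lambda>c \<phi> S. scale c (\<phi> S)) even_envelope envelope_mul (\<lambda>\<phi> S. H (\<phi> S))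
    (grassmann_envelope A)"
proof -
  have H0: "H x = H 0 \<longleftrightarrow> x = 0" if "x \<in> C" for x
    using inj_onD[OF inj_H _ that zero_C] by auto
  show ?thesis
  proof unfold_locales
    fix a b :: 'k and x y z :: "nat set \<Rightarrow> 'b"
    show "(\<lambda>S. scale a ((x + y) S)) = (\<lambda>S. scale a (x S)) + (\<lambda>S. scale a (y S))"
      by (auto simp: scale_right_distrib)
    show "(\<lambda>S. scale (a + b) (x S)) = (\<lambda>S. scale a (x S)) + (\<lambda>S. scale b (x S))"
      by (auto simp: scale_left_distrib)
    show "(\<lambda>S. scale a (scale b (x S))) = (\<lambda>S. scale (a * b) (x S))" "(\<lambda>S. scale 1 (x S)) = x"
      by auto
    show "0 \<in> even_envelope" by (simp add: even_envelope_def zero_C)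
    assume x: "x \<in> even_envelope"
    show s: "(\<lambda>S. scale a (x S)) \<in> even_envelope"
    proof -
      have "finite {S. scale a (x S) \<noteq> 0}"
        by (rule finite_subset[of _ "{S. x S \<noteq> 0}"]) (use x in \<open>auto simp: even_envelope_def\<close>)
      then show ?thesis using x by (simp add: even_envelope_def scale_C)
    qed
    show "a \<odot>\<^bsub>grassmann_envelope A\<^esub> (\<lambda>S. H (x S)) = (\<lambda>S. H (scale a (x S)))"
      using x by (simp add: grassmann_envelope_def smult_A envelope_C)
    assume y: "y \<in> even_envelope"
    show "x + y \<in> even_envelope"
    proof -
      have "finite {S. (x + y) S \<noteq> 0}"
        by (rule finite_subset[of _ "{S. x S \<noteq> 0} \<union> {S. y S \<noteq> 0}"])
          (use x y in \<open>auto simp: even_envelope_def\<close>)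
      then show ?thesis using x y by (simp add: even_envelope_def add_C)
    qed
    show "envelope_mul x y \<in> even_envelope" using x y by (rule envelope_mul_closed)
    show "envelope_mul (\<lambda>S. scale a (x S)) y = (\<lambda>S. scale a (envelope_mul x y S))"
      "envelope_mul x (\<lambda>S. scale a (y S)) = (\<lambda>S. scale a (envelope_mul x y S))"
      using x y by (auto simp: envelope_mul_def mul_scale_left mul_scale_right envelope_C
          scale_sum_right mult.commute intro!: ext sum.cong)
    show "(\<lambda>S. H (x S)) \<oplus>\<^bsub>grassmann_envelope A\<^esub> (\<lambda>S. H (y S)) = (\<lambda>S. H ((x + y) S))"
      using x y by (simp add: grassmann_envelope_def add_A envelope_C)
    show "(\<lambda>S. H (x S)) \<otimes>\<^bsub>grassmann_envelope A\<^esub> (\<lambda>S. H (y S)) = (\<lambda>S. H (envelope_mul x y S))"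
      using x y by (auto simp: grassmann_envelope_def mult_A smult_A envelope_C mul_C scale_C
          finsum_A envelope_mul_def zero_A)
    assume z: "z \<in> even_envelope"
    show "envelope_mul (x + y) z = envelope_mul x z + envelope_mul y z"
      "envelope_mul x (y + z) = envelope_mul x y + envelope_mul x z"
      using x y z by (auto simp: envelope_mul_def mul_add_left mul_add_right envelope_C
          scale_right_distrib sum.distrib intro!: ext)
  next
    show "carrier (grassmann_envelope A) = (\<lambda>\<phi> S. H (\<phi> S)) ` even_envelope"
    proof (intro Set.set_eqI iffI)
      fix f assume f: "f \<in> carrier (grassmann_envelope A)"
      define \<phi> where "\<phi> S = inv_into C H (f S)" for S
      have inC: "f S \<in> H ` C" for S
      proof (cases "finite S \<and> even (card S)")
        case True
        then have "f S \<in> part A (of_nat (card S))" using f by (simp add: grassmann_envelope_def)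
        then show ?thesis using True by (simp add: part_0 part_1 carrier_A of_nat_bit)
      next
        case False
        then have "f S = \<zero>\<^bsub>A\<^esub>"
          using f by (cases "finite S") (auto simp: grassmann_envelope_def of_nat_bit part_0 part_1 split: if_splits)
        then show ?thesis by (simp add: zero_A zero_C)
      qed
      have C: "\<phi> S \<in> C" and f_eq: "f S = H (\<phi> S)" for S
        using inv_into_into[OF inC] f_inv_into_f[OF inC] by (simp_all add: \<phi>_def)
      have "\<phi> S = 0" if "infinite S \<or> odd (card S)" for S
        using that f H0[OF C[of S]]
        by (cases "finite S") (auto simp: grassmann_envelope_def of_nat_bit part_0 part_1 f_eq zero_A split: if_splits)
      moreover have "finite {S. \<phi> S \<noteq> 0}"
        using f H0[OF C] by (simp add: grassmann_envelope_def f_eq zero_A)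
      ultimately have "\<phi> \<in> even_envelope" by (simp add: even_envelope_def C)
      then show "f \<in> (\<lambda>\<phi> S. H (\<phi> S)) ` even_envelope"
        using f_eq by (intro image_eqI[of _ _ \<phi>]) auto
    next
      fix f assume "f \<in> (\<lambda>\<phi> S. H (\<phi> S)) ` even_envelope"
      then obtain \<phi> where \<phi>: "\<phi> \<in> even_envelope" "f = (\<lambda>S. H (\<phi> S))" by blast
      then have "{S. f S \<noteq> \<zero>\<^bsub>A\<^esub>} = {S. \<phi> S \<noteq> 0}"
        by (auto simp: zero_A H0 envelope_C)
      then show "f \<in> carrier (grassmann_envelope A)"
        using \<phi> by (auto simp: grassmann_envelope_def even_envelope_def of_nat_bit part_0 part_1 zero_A
            carrier_A)
    qed
    show "\<zero>\<^bsub>grassmann_envelope A\<^esub> = (\<lambda>S. H (0 S))"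
      by (simp add: grassmann_envelope_def zero_A)
  qed
qed

end

context algebra_image
begin

text \<open>
Extension of scalars by the commutative associative algebra \<open>G\<^sub>0\<close> preserves the multilinear
identities of the variety: once the factors of all triple sums stand in the same order, the
coefficients of every ordered partition satisfy the identity in \<open>C\<close>.
\<close>

lemma envelope_satisfies_V_eps:
  assumes alg: "algebra_image (\<lambda>c \<phi> S. scale c (\<phi> S)) even_envelope envelope_mul K B"
    and sat: "satisfies_V_eps scale C mul \<epsilon>"
  shows "satisfies_V_eps (\<lambda>c \<phi> S. scale c (\<phi> S)) even_envelope envelope_mul \<epsilon>"
proof -
  interpret E: algebra_image "\<lambda>c \<phi> S. scale c (\<phi> S)" even_envelope envelope_mul K B by fact
  have m: "mul (mul x y) (mul z t) = 0" if "x \<in> C" "y \<in> C" "z \<in> C" "t \<in> C" for x y z t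
    using sat that unfolding satisfies_V_eps_def by blast
  have a: "mul (mul x y) z - mul x (mul y z) = scale \<epsilon> (mul (mul x z) y - mul x (mul z y))"
    if "x \<in> C" "y \<in> C" "z \<in> C" for x y z
    using sat that unfolding satisfies_V_eps_def by blast
  have b: "mul (mul x y - scale \<epsilon> (mul y x)) z
      - scale \<epsilon> (mul z (mul x y - scale \<epsilon> (mul y x))) = 0"
    if "x \<in> C" "y \<in> C" "z \<in> C" for x y z
    using sat that unfolding satisfies_V_eps_def by blast
  have b': "mul (mul x y) z - scale \<epsilon> (mul (mul y x) z)
      - scale \<epsilon> (mul z (mul x y) - scale \<epsilon> (mul z (mul y x))) = 0"
    if "x \<in> C" "y \<in> C" "z \<in> C" for x y z
    using b[OF that] that
    by (simp add: mul_diff_left mul_diff_right mul_C scale_C mul_scale_left mul_scale_right)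
  let ?L = "\<lambda>x y z. mul (mul x y) z" and ?R = "\<lambda>x y z. mul x (mul y z)"
  have L: "envelope_mul (envelope_mul \<phi> \<psi>) \<chi> U = (if finite U then three_sum ?L \<phi> \<psi> \<chi> U else 0)"
    if "\<phi> \<in> even_envelope" "\<psi> \<in> even_envelope" "\<chi> \<in> even_envelope" for \<phi> \<psi> \<chi> U
  proof (cases "finite U")
    case True
    then show ?thesis using that by (simp add: envelope_mul_left envelope_C three_sum_def)
  qed (simp add: envelope_mul_def)
  have R: "envelope_mul \<phi> (envelope_mul \<psi> \<chi>) U = (if finite U then three_sum ?R \<phi> \<psi> \<chi> U else 0)"
    if "\<phi> \<in> even_envelope" "\<psi> \<in> even_envelope" "\<chi> \<in> even_envelope" for \<phi> \<psi> \<chi> U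
  proof (cases "finite U")
    case True
    then show ?thesis using that by (simp add: envelope_mul_right envelope_C three_sum_def)
  qed (simp add: envelope_mul_def)
  have diff: "three_sum t \<phi> \<psi> \<chi> U - three_sum t' \<phi> \<psi> \<chi> U = three_sum (\<lambda>x y z. t x y z - t' x y z) \<phi> \<psi> \<chi> U"
    for t t' \<phi> \<psi> \<chi> U
    by (simp add: three_sum_def scale_right_diff_distrib sum_subtractf case_prod_unfold)
  have scl: "scale c (three_sum t \<phi> \<psi> \<chi> U) = three_sum (\<lambda>x y z. scale c (t x y z)) \<phi> \<psi> \<chi> U"
    for c t \<phi> \<psi> \<chi> U
    by (simp add: three_sum_def scale_sum_right case_prod_unfold mult.commute)
  have cong: "three_sum t \<phi> \<psi> \<chi> U = three_sum t' \<phi> \<psi> \<chi> U"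
    if "\<phi> \<in> even_envelope" "\<psi> \<in> even_envelope" "\<chi> \<in> even_envelope"
      "\<And>x y z. \<lbrakk>x \<in> C; y \<in> C; z \<in> C\<rbrakk> \<Longrightarrow> t x y z = t' x y z" for t t' \<phi> \<psi> \<chi> U
    using that by (simp add: three_sum_def envelope_C)
  have null: "three_sum (\<lambda>x y z. 0) \<phi> \<psi> \<chi> U = 0" for \<phi> \<psi> \<chi> U
    by (simp add: three_sum_def)
  show ?thesis
    unfolding satisfies_V_eps_def
  proof (intro conjI ballI ext)
    fix \<phi> \<psi> \<chi> \<theta> U
    assume "\<phi> \<in> even_envelope" "\<psi> \<in> even_envelope" "\<chi> \<in> even_envelope" "\<theta> \<in> even_envelope"
    then show "envelope_mul (envelope_mul \<phi> \<psi>) (envelope_mul \<chi> \<theta>) U = 0 U"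
      by (auto simp: envelope_mul_def mul_sum_left mul_sum_right m envelope_C mul_C scale_C sum_C
          mul_scale_left mul_scale_right mul_zero zero_C intro!: sum.neutral)
  next
    fix \<phi> \<psi> \<chi> :: "nat set \<Rightarrow> 'b" and U :: "nat set"
    assume e: "\<phi> \<in> even_envelope" "\<psi> \<in> even_envelope" "\<chi> \<in> even_envelope"
    show "(envelope_mul (envelope_mul \<phi> \<psi>) \<chi> - envelope_mul \<phi> (envelope_mul \<psi> \<chi>)) U =
       scale \<epsilon> ((envelope_mul (envelope_mul \<phi> \<chi>) \<psi> - envelope_mul \<phi> (envelope_mul \<chi> \<psi>)) U)"
    proof (cases "finite U")
      case True
      have 1: "three_sum ?L \<phi> \<chi> \<psi> U = three_sum (\<lambda>x y z. mul (mul x z) y) \<phi> \<psi> \<chi> U"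
        using True e by (intro three_sum_swap_right) (simp_all add: mul_zero mul_C)
      have 2: "three_sum ?R \<phi> \<chi> \<psi> U = three_sum (\<lambda>x y z. mul x (mul z y)) \<phi> \<psi> \<chi> U"
        using True e by (intro three_sum_swap_right) (simp_all add: mul_zero mul_C)
      show ?thesis
        using True e by (simp add: L R 1 2 diff scl) (rule cong[OF e], rule a)
    qed (simp add: L R e)
  next
    fix \<phi> \<psi> \<chi> :: "nat set \<Rightarrow> 'b" and U :: "nat set"
    assume e: "\<phi> \<in> even_envelope" "\<psi> \<in> even_envelope" "\<chi> \<in> even_envelope"
    have eq: "envelope_mul (envelope_mul \<phi> \<psi> - (\<lambda>S. scale \<epsilon> (envelope_mul \<psi> \<phi> S))) \<chi> -
        (\<lambda>S. scale \<epsilon> (envelope_mul \<chi> (envelope_mul \<phi> \<psi> - (\<lambda>S. scale \<epsilon> (envelope_mul \<psi> \<phi> S))) S))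
      = (envelope_mul (envelope_mul \<phi> \<psi>) \<chi> - (\<lambda>S. scale \<epsilon> (envelope_mul (envelope_mul \<psi> \<phi>) \<chi> S))) -
        (\<lambda>S. scale \<epsilon> ((envelope_mul \<chi> (envelope_mul \<phi> \<psi>) - (\<lambda>S. scale \<epsilon> (envelope_mul \<chi> (envelope_mul \<psi> \<phi>) S))) S))"
      using e by (simp add: E.mul_diff_left E.mul_diff_right E.mul_C E.scale_C E.mul_scale_left E.mul_scale_right)
    have "((envelope_mul (envelope_mul \<phi> \<psi>) \<chi> - (\<lambda>S. scale \<epsilon> (envelope_mul (envelope_mul \<psi> \<phi>) \<chi> S))) -
        (\<lambda>S. scale \<epsilon> ((envelope_mul \<chi> (envelope_mul \<phi> \<psi>) - (\<lambda>S. scale \<epsilon> (envelope_mul \<chi> (envelope_mul \<psi> \<phi>) S))) S))) U = 0"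
    proof (cases "finite U")
      case True
      have 1: "three_sum ?L \<psi> \<phi> \<chi> U = three_sum (\<lambda>x y z. mul (mul y x) z) \<phi> \<psi> \<chi> U"
        using True e by (intro three_sum_swap_left) (simp_all add: mul_zero mul_C)
      have "three_sum ?R \<chi> \<phi> \<psi> U = three_sum (\<lambda>x y z. mul y (mul x z)) \<phi> \<chi> \<psi> U"
        using True e by (intro three_sum_swap_left) (simp_all add: mul_zero mul_C)
      also have "\<dots> = three_sum (\<lambda>x y z. mul z (mul x y)) \<phi> \<psi> \<chi> U"
        using True e by (intro three_sum_swap_right) (simp_all add: mul_zero mul_C)
      finally have 2: "three_sum ?R \<chi> \<phi> \<psi> U = three_sum (\<lambda>x y z. mul z (mul x y)) \<phi> \<psi> \<chi> U" .
      have "three_sum ?R \<chi> \<psi> \<phi> U = three_sum (\<lambda>x y z. mul y (mul x z)) \<psi> \<chi> \<phi> U"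
        using True e by (intro three_sum_swap_left) (simp_all add: mul_zero mul_C)
      also have "\<dots> = three_sum (\<lambda>x y z. mul z (mul x y)) \<psi> \<phi> \<chi> U"
        using True e by (intro three_sum_swap_right) (simp_all add: mul_zero mul_C)
      also have "\<dots> = three_sum (\<lambda>x y z. mul z (mul y x)) \<phi> \<psi> \<chi> U"
        using True e by (intro three_sum_swap_left) (simp_all add: mul_zero mul_C)
      finally have 3: "three_sum ?R \<chi> \<psi> \<phi> U = three_sum (\<lambda>x y z. mul z (mul y x)) \<phi> \<psi> \<chi> U" .
      show ?thesis
        using True e by (simp add: L R 1 2 3 diff scl del: scale_scale) (subst null[symmetric, of \<phi> \<psi> \<chi> U], rule cong[OF e], rule b')
    qed (simp add: L R e)
    then show "(envelope_mul (envelope_mul \<phi> \<psi> - (\<lambda>S. scale \<epsilon> (envelope_mul \<psi> \<phi> S))) \<chi> -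
        (\<lambda>S. scale \<epsilon> (envelope_mul \<chi> (envelope_mul \<phi> \<psi> - (\<lambda>S. scale \<epsilon> (envelope_mul \<psi> \<phi> S))) S))) U
      = 0 U" by (simp only: eq zero_fun_apply)
  qed
qed

end

context even_superalgebra_image
begin

lemma superalgebra_A: "superalgebra A"
proof -
  interpret N: nonassoc_algebra A by (rule nonassoc_algebra_A)
  have z: "submodule {\<zero>\<^bsub>A\<^esub>} (ring_of_type_algebra :: 'k ring) A"
  proof (rule N.submoduleI)
    show "c \<odot>\<^bsub>A\<^esub> x \<in> {\<zero>\<^bsub>A\<^esub>}" if "x \<in> {\<zero>\<^bsub>A\<^esub>}" for c x
      using that by (simp add: zero_A smult_A zero_C)
  qed auto
  show ?thesis
  proof (intro superalgebra.intro superalgebra_axioms.intro)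
    show "nonassoc_algebra A" by (rule nonassoc_algebra_A)
    show "submodule (part A i) (ring_of_type_algebra :: 'k ring) A" for i
      using bit_cases[of i] z N.carrier_is_submodule part_0 part_1 by auto
    show "part A 0 \<inter> part A 1 = {\<zero>\<^bsub>A\<^esub>}" by (auto simp: part_0 part_1)
    show "carrier A = part A 0 <+>\<^bsub>A\<^esub> part A 1"
      by (auto simp: part_0 part_1 set_add_def')
    show "x \<otimes>\<^bsub>A\<^esub> y \<in> part A (i + j)" if "x \<in> part A i" "y \<in> part A j" for x y i j
      using bit_cases[of i] bit_cases[of j] that
      by (auto simp: part_0 part_1 zero_A carrier_A mult_A mul_C mul_zero zero_C)
  qed
qed

end

lemma even_superalgebra_in_super_class:
  fixes A :: "('k::field, 'a) superalgebra"
  assumes "even_superalgebra_image scale C mul H A" "satisfies_V_eps scale C mul \<epsilon>"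
  shows "A \<in> super_class (V_eps \<epsilon>)"
proof -
  interpret even_superalgebra_image scale C mul H A by fact
  show ?thesis
    unfolding super_class_def
    using superalgebra_A image_in_V_eps[OF algebra_image_envelope
        envelope_satisfies_V_eps[OF algebra_image_envelope assms(2)]] by simp
qed

section \<open>An algebra of the variety that separates the nested words\<close>

text \<open>
The model is \<open>V \<oplus> M\<close> with \<open>V V = M M = 0\<close>. Elements of \<open>V\<close> are pairs \<open>(y, z)\<close> of a sequence (the
coordinates \<open>Y\<close>) and a scalar (the coordinate \<open>Z\<close>), those of \<open>M\<close> are triples \<open>(m\<^sub>0, m\<^sub>1, m\<^sub>2)\<close> of
sequences. With \<open>(D\<^sub>y m)(k) = y(k) m(k + 1)\<close>, the bimodule \<open>M\<close> is given by
\<open>m R\<^bsub>(y, z)\<^esub> = (z m\<^sub>1 - D\<^sub>y m\<^sub>2, 0, 0)\<close>, \<open>m T\<^bsub>(y, z)\<^esub> = (0, D\<^sub>y m\<^sub>0, z m\<^sub>0)\<close> and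
\<open>L = \<epsilon> (R - T)\<close>. Then \<open>R R' = T T' = 0\<close> and \<open>T R' + T' R = 0\<close>, which imply the
identities of the variety. The shift in \<open>D\<close> makes the values of \<open>y\<close> at \<open>0, 1, 2, \<dots>\<close> visible one after
the other and so records the order in which the factors \<open>T\<^bsub>(y, z)\<^esub>\<close> are applied.
\<close>

datatype coordinate = Y nat | Z | M0 nat | M1 nat | M2 nat

definition model_mul :: "'k::field \<Rightarrow> (coordinate \<Rightarrow> 'k) \<Rightarrow> (coordinate \<Rightarrow> 'k) \<Rightarrow> coordinate \<Rightarrow> 'k" where
  "model_mul \<epsilon> a b = (\<lambda>c. case c of
     Y k \<Rightarrow> 0 | Z \<Rightarrow> 0
   | M0 k \<Rightarrow> (b Z * a (M1 k) - b (Y k) * a (M2 (Suc k)))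
           + \<epsilon> * (a Z * b (M1 k) - a (Y k) * b (M2 (Suc k)))
   | M1 k \<Rightarrow> - \<epsilon> * (a (Y k) * b (M0 (Suc k)))
   | M2 k \<Rightarrow> - \<epsilon> * (a Z * b (M0 k)))"

lemma model_mul_simps [simp]:
  "model_mul \<epsilon> a b (Y k) = 0" "model_mul \<epsilon> a b Z = 0"
  "model_mul \<epsilon> a b (M0 k) = (b Z * a (M1 k) - b (Y k) * a (M2 (Suc k)))
      + \<epsilon> * (a Z * b (M1 k) - a (Y k) * b (M2 (Suc k)))"
  "model_mul \<epsilon> a b (M1 k) = - \<epsilon> * (a (Y k) * b (M0 (Suc k)))"
  "model_mul \<epsilon> a b (M2 k) = - \<epsilon> * (a Z * b (M0 k))"
  by (simp_all add: model_mul_def)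

lemma model_satisfies_V_eps:
  assumes "\<epsilon> \<in> {1, - 1 :: 'k::field}"
  shows "satisfies_V_eps (\<lambda>c a i. c * a i) UNIV (model_mul \<epsilon>) \<epsilon>"
proof -
  have e: "\<epsilon> * \<epsilon> = 1" using assms by auto
  then have e': "\<epsilon> * (\<epsilon> * x) = x" for x by (simp flip: mult.assoc)
  show ?thesis
    unfolding satisfies_V_eps_def
  proof (intro conjI ballI ext)
    fix x y z t :: "coordinate \<Rightarrow> 'k" and i
    show "model_mul \<epsilon> (model_mul \<epsilon> x y) (model_mul \<epsilon> z t) i = 0 i"
      by (cases i) simp_all
    show "(model_mul \<epsilon> (model_mul \<epsilon> x y) z - model_mul \<epsilon> x (model_mul \<epsilon> y z)) i =
        \<epsilon> * (model_mul \<epsilon> (model_mul \<epsilon> x z) y - model_mul \<epsilon> x (model_mul \<epsilon> z y)) i"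
      using assms by (cases i) (auto simp: algebra_simps e e')
    show "(model_mul \<epsilon> (model_mul \<epsilon> x y - (\<lambda>i. \<epsilon> * model_mul \<epsilon> y x i)) z -
        (\<lambda>i. \<epsilon> * model_mul \<epsilon> z (model_mul \<epsilon> x y - (\<lambda>i. \<epsilon> * model_mul \<epsilon> y x i)) i)) i = 0 i"
      using assms by (cases i) (auto simp: algebra_simps e e')
  qed
qed

text \<open>
The model has to be realised on elements of the type \<open>'k univ\<close>; the coordinates are named by distinct
monomials, and a vector is encoded as the set of all functions with these values.
\<close>

definition model_code :: "(coordinate \<Rightarrow> 'k) \<Rightarrow> (nat monomial \<Rightarrow> 'k) set" where
  "model_code a = {b. \<forall>i. b (case i of Y k \<Rightarrow> Prod (Var 0) (Var k) | Z \<Rightarrow> Var 0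
     | M0 k \<Rightarrow> Prod (Var 1) (Var k) | M1 k \<Rightarrow> Prod (Var 2) (Var k) | M2 k \<Rightarrow> Prod (Var 3) (Var k)) = a i}"

definition model_superalgebra :: "'k::field \<Rightarrow> ('k, 'k univ) superalgebra" where
  "model_superalgebra \<epsilon> =
    \<lparr>carrier = range model_code,
     monoid.mult = (\<lambda>x y. model_code (model_mul \<epsilon> (inv_into UNIV model_code x) (inv_into UNIV model_code y))),
     one = model_code 0,
     zero = model_code 0,
     add = (\<lambda>x y. model_code (inv_into UNIV model_code x + inv_into UNIV model_code y)),
     module.smult = (\<lambda>c x. model_code (\<lambda>i. c * inv_into UNIV model_code x i)),
     part = (\<lambda>i. if i = 0 then range model_code else {model_code 0})\<rparr>"

lemma inj_model_code: "inj model_code"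
proof (rule injI)
  fix a a' :: "coordinate \<Rightarrow> 'k"
  assume eq: "model_code a = model_code a'"
  define b where "b w = (case w of Var _ \<Rightarrow> a Z | Prod (Var j) (Var k) \<Rightarrow>
      if j = 0 then a (Y k) else if j = 1 then a (M0 k) else if j = 2 then a (M1 k) else a (M2 k)
    | _ \<Rightarrow> a Z)" for w :: "nat monomial"
  have "b \<in> model_code a"
    by (auto simp: model_code_def b_def split: coordinate.splits)
  then have b: "b \<in> model_code a" "b \<in> model_code a'" using eq by auto
  show "a = a'"
  proof
    fix i show "a i = a' i" using b by (auto simp: model_code_def)
  qed
qed

lemma model_even_superalgebra_image:
  "even_superalgebra_image (\<lambda>c a i. c * a i) UNIV (model_mul \<epsilon>) model_code (model_superalgebra \<epsilon>)"
  by unfold_locales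
    (auto simp: model_superalgebra_def inj_model_code algebra_simps fun_eq_iff model_mul_def
      split: coordinate.splits)

section \<open>Linear equations and growth\<close>

text \<open>
Gaussian elimination of one unknown per equation.
\<close>

lemma underdetermined_system_has_solution:
  fixes M :: "'e \<Rightarrow> 'x \<Rightarrow> 'k::field"
  assumes "finite E" "finite V" "card E < card V"
  shows "\<exists>c. (\<exists>x\<in>V. c x \<noteq> 0) \<and> (\<forall>e\<in>E. (\<Sum>x\<in>V. M e x * c x) = 0)"
  using assms
proof (induction E arbitrary: M V rule: finite_induct)
  case empty
  then obtain x where "x \<in> V" by (metis card.empty ex_in_conv less_irrefl)
  then show ?case by (intro exI[of _ "\<lambda>_. 1"]) auto
next
  case (insert e E)
  show ?case
  proof (cases "\<forall>x\<in>V. M e x = 0")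
    case True
    have "card E < card V" using insert by simp
    then obtain c where "\<exists>x\<in>V. c x \<noteq> 0" "\<forall>e\<in>E. (\<Sum>x\<in>V. M e x * c x) = 0"
      using insert.IH[of V M] insert.prems by blast
    then show ?thesis using True by (intro exI[of _ c]) auto
  next
    case False
    then obtain x0 where x0: "x0 \<in> V" "M e x0 \<noteq> 0" by blast
    let ?V = "V - {x0}" and ?M = "\<lambda>e' x. M e' x - M e' x0 * M e x / M e x0"
    have "card E < card ?V" using insert x0 by simp
    then obtain c where c: "\<exists>x\<in>?V. c x \<noteq> 0" "\<forall>e'\<in>E. (\<Sum>x\<in>?V. ?M e' x * c x) = 0"
      using insert.IH[of ?V ?M] insert.prems(1) by auto
    \<comment> \<open>The value at the eliminated unknown is chosen to satisfy the equation of \<open>e\<close>.\<close>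
    define c' where "c' = c(x0 := - (\<Sum>x\<in>?V. M e x * c x) / M e x0)"
    have split: "(\<Sum>x\<in>V. M e' x * c' x)
        = (\<Sum>x\<in>?V. M e' x * c x) - M e' x0 / M e x0 * (\<Sum>x\<in>?V. M e x * c x)" for e'
    proof -
      have "(\<Sum>x\<in>?V. M e' x * c' x) = (\<Sum>x\<in>?V. M e' x * c x)"
        by (rule sum.cong) (auto simp: c'_def)
      then show ?thesis
        using x0 insert.prems by (simp add: sum.remove[of V x0] c'_def)
    qed
    have "(\<Sum>x\<in>V. M e' x * c' x) = (\<Sum>x\<in>?V. ?M e' x * c x)" for e'
      unfolding split by (simp add: sum_distrib_left sum_subtractf algebra_simps)
    moreover have "(\<Sum>x\<in>V. M e x * c' x) = 0" using x0 by (simp add: split)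
    moreover have "\<exists>x\<in>V. c' x \<noteq> 0" using c(1) by (auto simp: c'_def)
    ultimately show ?thesis using c(2) by (intro exI[of _ c']) auto
  qed
qed

lemma exponential_less_fact:
  fixes C q :: nat
  obtains n where "C * q ^ n < fact n"
proof -
  have "(\<lambda>n. inverse (fact n) * real q ^ n) \<longlonglongrightarrow> 0"
    by (rule summable_LIMSEQ_zero) (rule summable_exp)
  then have "\<forall>\<^sub>F n in sequentially. inverse (fact n) * real q ^ n < inverse (real C + 1)"
    by (rule order_tendstoD) simp
  then obtain n where n: "inverse (fact n) * real q ^ n < inverse (real C + 1)"
    by (auto simp: eventually_sequentially)
  then have "(real C + 1) * real q ^ n < fact n" by (simp add: field_simps)
  then have "real (C * q ^ n) < real (fact n)"
    by (smt (verit) of_nat_fact of_nat_mult of_nat_power mult_right_mono of_nat_0_le_iff zero_le_power distrib_right)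
  then show ?thesis using that of_nat_less_iff by blast
qed

section \<open>Nested words\<close>

text \<open>
Permutations of \<open>{..<n}\<close> as lists: the list of the indices of the variables \<open>y\<^sub>i\<close> in a nested word,
from the outermost to the innermost.
\<close>

definition orderings :: "nat \<Rightarrow> nat list set" where
  "orderings n = {ks. distinct ks \<and> set ks = {..<n}}"

lemma length_orderings: "ks \<in> orderings n \<Longrightarrow> length ks = n"
  using distinct_card[of ks] by (simp add: orderings_def)

lemma orderings_bij_betw: "ks \<in> orderings n \<Longrightarrow> bij_betw ((!) ks) {..<n} {..<n}"
  using length_orderings[of ks n] by (intro bij_betw_nth) (auto simp: orderings_def)

lemma orderings_eq: "orderings n = {ks. length ks = n \<and> distinct ks \<and> set ks \<subseteq> {..<n}}"
proof -
  have "set ks = {..<n}" if "distinct ks" "set ks \<subseteq> {..<n}" "length ks = n" for ks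
    using that by (intro card_subset_eq) (simp_all add: distinct_card)
  then show ?thesis using length_orderings by (auto simp: orderings_def)
qed

lemma finite_orderings: "finite (orderings n)"
  by (rule finite_subset[OF _ finite_lists_length_eq[of "{..<n}" n]]) (auto simp: orderings_eq)

lemma card_orderings: "card (orderings n) = fact n"
proof -
  have "card (orderings n) = \<Prod>{card {..<n} - n + 1..card {..<n}}"
    unfolding orderings_eq by (rule card_lists_distinct_length_eq) auto
  then show ?thesis by (simp add: fact_prod)
qed

text \<open>
The variables \<open>x\<^sub>0, x\<^sub>1, y\<^sub>i, z\<^sub>j\<close> have the numbers \<open>0, 1, 2 i + 2, 2 j + 3\<close>, which do not depend on the
length of the word. The \<open>z\<^sub>j\<close> occur in the same order in all nested words; only the \<open>y\<^sub>i\<close> are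
permuted.
\<close>

primrec nested_word :: "nat list \<Rightarrow> nat monomial" where
  "nested_word [] = Prod (Var 0) (Var 1)"
| "nested_word (i # ks) = Prod (Prod (Var (2 * i + 2)) (nested_word ks)) (Var (2 * length ks + 3))"

lemma inj_nested_word: "inj nested_word"
proof (rule injI)
  fix ks js show "nested_word ks = nested_word js \<Longrightarrow> ks = js"
  proof (induction ks arbitrary: js)
    case Nil
    then show ?case by (cases js) auto
  next
    case (Cons i ks)
    then show ?case by (cases js) auto
  qed
qed

lemma set_letters_nested_word:
  "set (letters (nested_word ks)) = {0, 1} \<union> (\<lambda>i. 2 * i + 2) ` set ks \<union> (\<lambda>j. 2 * j + 3) ` {..<length ks}"
  by (induction ks) (auto simp: lessThan_Suc)

lemma distinct_letters_nested_word: "distinct ks \<Longrightarrow> distinct (letters (nested_word ks))"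
proof (induction ks)
  case (Cons i ks)
  have "2 * i + 2 \<noteq> 2 * j + 3" for j :: nat by presburger
  then show ?case using Cons by (auto simp: set_letters_nested_word) presburger+
qed simp

lemma set_letters_ordering:
  assumes "ks \<in> orderings n"
  shows "set (letters (nested_word ks)) = {..<2 * n + 2}"
proof -
  have "x \<in> {0, 1} \<union> (\<lambda>i. 2 * i + 2) ` {..<n} \<union> (\<lambda>j. 2 * j + 3) ` {..<n}" if "x < 2 * n + 2" for x :: nat
  proof (cases "even x")
    case True
    then obtain k where "x = 2 * k" by (rule evenE)
    then show ?thesis using that by (cases k) auto
  next
    case False
    then obtain k where "x = 2 * k + 1" by (rule oddE)
    then show ?thesis using that by (cases k) auto
  qed
  then show ?thesis
    using assms by (auto simp: set_letters_nested_word length_orderings orderings_def[THEN eqset_imp_iff])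
qed

definition word_poly :: "nat \<Rightarrow> (nat list \<Rightarrow> 'k::field) \<Rightarrow> nat monomial \<Rightarrow> 'k" where
  "word_poly n c w = (\<Sum>ks \<in> {ks \<in> orderings n. nested_word ks = w}. c ks)"

lemma word_poly_nested_word: "ks \<in> orderings n \<Longrightarrow> word_poly n c (nested_word ks) = c ks"
proof -
  assume "ks \<in> orderings n"
  then have "{js \<in> orderings n. nested_word js = nested_word ks} = {ks}"
    by (auto simp: inj_eq[OF inj_nested_word])
  then show ?thesis by (simp add: word_poly_def)
qed

lemma word_poly_support: "word_poly n c w \<noteq> 0 \<Longrightarrow> w \<in> nested_word ` orderings n"
  by (rule ccontr) (auto simp: word_poly_def image_iff intro!: sum.neutral)

lemma multilinear_word_poly: "multilinear (2 * n + 2) (word_poly n c)"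
  unfolding multilinear_def
proof (intro conjI allI impI)
  show "finite {w. word_poly n c w \<noteq> 0}"
    by (rule finite_subset[of _ "nested_word ` orderings n"])
      (use word_poly_support finite_orderings in blast)+
  fix w assume "word_poly n c w \<noteq> 0"
  then obtain ks where "ks \<in> orderings n" "w = nested_word ks" using word_poly_support by blast
  then show "distinct (letters w)" "set (letters w) = {..<2 * n + 2}"
    using set_letters_ordering distinct_letters_nested_word by (auto simp: orderings_def)
qed

lemma (in vector_space) sum_word_poly:
  "(\<Sum>w | s w * word_poly n c w \<noteq> 0. scale (s w * word_poly n c w) (g w))
    = (\<Sum>ks\<in>orderings n. scale (s (nested_word ks) * c ks) (g (nested_word ks)))"
proof -
  have "(\<Sum>w | s w * word_poly n c w \<noteq> 0. scale (s w * word_poly n c w) (g w))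
      = (\<Sum>w\<in>nested_word ` orderings n. scale (s w * word_poly n c w) (g w))"
    using word_poly_support by (intro sum.mono_neutral_left) (auto simp: finite_orderings)
  also have "\<dots> = (\<Sum>ks\<in>orderings n. scale (s (nested_word ks) * c ks) (g (nested_word ks)))"
    using inj_nested_word by (simp add: sum.reindex inj_on_subset word_poly_nested_word)
  finally show ?thesis .
qed

lemma sum_fun_apply: "(sum f A) x = (\<Sum>a\<in>A. f a x)"
  by (induction A rule: infinite_finite_induct) simp_all

text \<open>
The substitution that isolates the ordering \<open>ks\<close>: the variable \<open>y\<^sub>i\<close> becomes the unit vector of the
position of \<open>i\<close> in \<open>ks\<close>, all \<open>z\<^sub>j\<close> and \<open>x\<^sub>1\<close> become the vector \<open>Z\<close>, and \<open>x\<^sub>0\<close> becomes the constant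
sequence \<open>1\<close> in \<open>M1\<close>, so that \<open>x\<^sub>0 x\<^sub>1\<close> is the constant sequence \<open>1\<close> in \<open>M0\<close>.
\<close>

definition ordering_valuation :: "nat \<Rightarrow> nat list \<Rightarrow> nat \<Rightarrow> coordinate \<Rightarrow> 'k::field" where
  "ordering_valuation n ks x = (\<lambda>i. case i of
     Y k \<Rightarrow> if even x \<and> x \<noteq> 0 \<and> inv_into {..<n} ((!) ks) (x div 2 - 1) = k then 1 else 0
   | Z \<Rightarrow> if odd x then 1 else 0
   | M1 k \<Rightarrow> if x = 0 then 1 else 0
   | _ \<Rightarrow> 0)"

text \<open>
On \<open>M0\<close> left multiplication by \<open>y\<close> is \<open>- \<epsilon> T\<^sub>y\<close>, so every factor \<open>L\<^sub>y R\<^sub>z\<close> acts as \<open>- \<epsilon> D\<^sub>y\<close>, and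
the coordinate \<open>k\<close> of the result multiplies the values of the successive \<open>y\<close>, from the outermost
inwards, at \<open>k, k + 1, \<dots>\<close>.
\<close>

lemma model_value_nested_word:
  "monomial_value (model_mul \<epsilon>) (ordering_valuation n ks) (nested_word js) =
    (\<lambda>i. case i of M0 k \<Rightarrow>
        if map (inv_into {..<n} ((!) ks)) js = [k..<k + length js] then (- \<epsilon>) ^ length js else 0
      | _ \<Rightarrow> 0)"
proof (induction js)
  case Nil
  show ?case by (rule ext) (auto simp: ordering_valuation_def split: coordinate.split)
next
  case (Cons j js)
  let ?v = "ordering_valuation n ks :: nat \<Rightarrow> coordinate \<Rightarrow> 'a"
  let ?w = "monomial_value (model_mul \<epsilon>) ?v (nested_word js)"
  have upt: "[k..<k + length (j # js)] = k # [Suc k..<Suc k + length js]" for k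
    by (simp add: upt_conv_Cons del: upt_Suc)
  have y: "?v (2 * j + 2) = (\<lambda>i. if i = Y (inv_into {..<n} ((!) ks) j) then 1 else 0)"
    by (rule ext) (auto simp: ordering_valuation_def split: coordinate.split)
  have "odd (2 * length js + 3)" by simp
  then have z: "?v (2 * length js + 3) = (\<lambda>i. if i = Z then 1 else 0)"
    by (auto simp: ordering_valuation_def fun_eq_iff split: coordinate.split)
  have w: "?w (M1 k) = 0" "?w (M2 k) = 0" "?w (M0 k) =
      (if map (inv_into {..<n} ((!) ks)) js = [k..<k + length js] then (- \<epsilon>) ^ length js else 0)" for k
    by (simp_all add: Cons)
  show ?case
    unfolding nested_word.simps monomial_value.simps y z upt list.map
    by (rule ext) (auto simp: w split: coordinate.split)
qed

text \<open>
Under \<open>ordering_valuation n ks\<close> the coordinate \<open>M0 0\<close> of the value is \<open>(- \<epsilon>)\<^sup>n c ks\<close>: an ordering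
survives only if it lists the \<open>y\<^sub>i\<close> by increasing position in \<open>ks\<close>, that is, if it equals \<open>ks\<close>.
\<close>

lemma word_poly_not_superidentity:
  fixes c :: "nat list \<Rightarrow> 'k::field"
  assumes "\<epsilon> \<in> {1, - 1}" "ks \<in> orderings n" "c ks \<noteq> 0"
  shows "\<not> satisfies_superidentity (model_superalgebra \<epsilon>) (word_poly n c)"
proof
  assume sat: "satisfies_superidentity (model_superalgebra \<epsilon>) (word_poly n c)"
  interpret M: even_superalgebra_image "\<lambda>c a i. c * a i" UNIV "model_mul \<epsilon>" model_code
    "model_superalgebra \<epsilon>" by (rule model_even_superalgebra_image)
  let ?a = "ordering_valuation n ks :: nat \<Rightarrow> coordinate \<Rightarrow> 'k"
  let ?pos = "inv_into {..<n} ((!) ks)"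
  have even: "superization (\<lambda>_. 0) (word_poly n c) = word_poly n c"
    by (simp add: superization_def koszul_sign_def fun_eq_iff)
  have "eval_poly (model_superalgebra \<epsilon>) (\<lambda>x. model_code (?a x)) (superization (\<lambda>_. 0) (word_poly n c))
      = \<zero>\<^bsub>model_superalgebra \<epsilon>\<^esub>"
    using sat[unfolded satisfies_superidentity_def, rule_format,
        of "\<lambda>x. model_code (?a x)" "\<lambda>_. 0"] by (simp add: M.part_0 M.carrier_A)
  then have "model_code (\<Sum>w | word_poly n c w \<noteq> 0.
      (\<lambda>i. word_poly n c w * monomial_value (model_mul \<epsilon>) ?a w i)) = model_code 0"
    by (simp add: even M.eval_poly_A M.zero_A)
  then have "(\<Sum>w | word_poly n c w \<noteq> 0.
      (\<lambda>i. word_poly n c w * monomial_value (model_mul \<epsilon>) ?a w i)) = 0"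
    by (rule injD[OF inj_model_code])
  then have "(\<Sum>js\<in>orderings n. (\<lambda>i. c js * monomial_value (model_mul \<epsilon>) ?a (nested_word js) i)) = 0"
    using M.sum_word_poly[of "\<lambda>_. 1" n c "monomial_value (model_mul \<epsilon>) ?a"] by simp
  from fun_cong[OF this, of "M0 0"]
  have "0 = (\<Sum>js\<in>orderings n.
      c js * (if map ?pos js = [0..<length js] then (- \<epsilon>) ^ length js else 0))"
    by (simp add: sum_fun_apply model_value_nested_word)
  also have "\<dots> = (\<Sum>js\<in>orderings n. c js * (if map ?pos js = [0..<n] then (- \<epsilon>) ^ n else 0))"
    by (rule sum.cong) (simp_all add: length_orderings)
  also have "\<dots> = (\<Sum>js\<in>orderings n. if js = ks then c js * (- \<epsilon>) ^ n else 0)"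
  proof (rule sum.cong)
    fix js assume js: "js \<in> orderings n"
    have "map ?pos js = [0..<n] \<longleftrightarrow> js = ks"
    proof
      assume eq: "map ?pos js = [0..<n]"
      show "js = ks"
      proof (rule nth_equalityI)
        show "length js = length ks" using js assms(2) by (simp add: length_orderings)
        fix k assume "k < length js"
        then have k: "k < n" "js ! k \<in> {..<n}"
          using js nth_mem[of k js] length_orderings[OF js] by (simp_all add: orderings_def)
        then have "?pos (js ! k) = k" using arg_cong[OF eq, of "\<lambda>l. l ! k"] js by (simp add: length_orderings)
        moreover have "ks ! ?pos (js ! k) = js ! k"
          using k orderings_bij_betw[OF assms(2)] by (intro f_inv_into_f) (auto simp: bij_betw_def)
        ultimately show "js ! k = ks ! k" by simp
      qed
    next
      assume "js = ks"
      then show "map ?pos js = [0..<n]"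
        using orderings_bij_betw[OF assms(2)] assms(2)
        by (intro nth_equalityI) (auto simp: length_orderings bij_betw_def inv_into_f_f)
    qed
    then show "c js * (if map ?pos js = [0..<n] then (- \<epsilon>) ^ n else 0)
        = (if js = ks then c js * (- \<epsilon>) ^ n else 0)" by simp
  qed simp
  also have "\<dots> = c ks * (- \<epsilon>) ^ n" using assms(2) by (simp add: finite_orderings)
  finally show False using assms by auto
qed

section \<open>Coefficients that vanish on finitely many generators\<close>

text \<open>
Here \<open>x i g\<close> is the coefficient of the generator \<open>g\<close> in the argument for \<open>y\<^sub>i\<close>, and \<open>h j\<close> is the
generator at the position \<open>j\<close>. The product for \<open>ks\<close> depends only on the assignment \<open>g\<close> of generators
to variables that \<open>h\<close> induces through \<open>ks\<close>. Grouping the orderings by this assignment leaves one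
equation, independent of \<open>x\<close>, for every \<open>g\<close>.
\<close>

lemma ordering_product_sum_zero:
  fixes t :: "nat list \<Rightarrow> 'k::field" and x :: "nat \<Rightarrow> nat \<Rightarrow> 'k"
  assumes h: "\<And>j. j < n \<Longrightarrow> h j < d"
    and zero: "\<And>g. g \<in> {..<n} \<rightarrow>\<^sub>E {..<d} \<Longrightarrow>
      (\<Sum>ks\<in>orderings n. if \<forall>j<n. g (ks ! j) = h j then t ks else 0) = 0"
  shows "(\<Sum>ks\<in>orderings n. t ks * (\<Prod>j<n. x (ks ! j) (h j))) = 0"
proof -
  \<comment> \<open>The induced assignment of generators to variables.\<close>
  define place where "place ks = (\<lambda>i\<in>{..<n}. h (inv_into {..<n} ((!) ks) i))" for ks
  let ?G = "{..<n} \<rightarrow>\<^sub>E {..<d}"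
  have pos: "inv_into {..<n} ((!) ks) (ks ! j) = j" "ks ! j < n" if "ks \<in> orderings n" "j < n" for ks j
    using orderings_bij_betw[OF that(1)] that(2) by (auto simp: bij_betw_def inv_into_f_f)
  have pos': "inv_into {..<n} ((!) ks) i < n" "ks ! inv_into {..<n} ((!) ks) i = i"
    if "ks \<in> orderings n" "i < n" for ks i
    using orderings_bij_betw[OF that(1)] that(2) inv_into_into[of i "(!) ks" "{..<n}"]
      f_inv_into_f[of i "(!) ks" "{..<n}"] by (auto simp: bij_betw_def)
  have place: "place ks \<in> ?G" if "ks \<in> orderings n" for ks
    using h pos'[OF that] by (auto simp: place_def)
  have prod: "(\<Prod>j<n. x (ks ! j) (h j)) = (\<Prod>i<n. x i (place ks i))" if ks: "ks \<in> orderings n" for ks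
  proof -
    have "(\<Prod>j<n. x (ks ! j) (h j)) = (\<Prod>j<n. x (ks ! j) (place ks (ks ! j)))"
      using pos[OF ks] by (intro prod.cong) (auto simp: place_def)
    also have "\<dots> = (\<Prod>i<n. x i (place ks i))"
      by (rule prod.reindex_bij_betw[OF orderings_bij_betw[OF ks]])
    finally show ?thesis .
  qed
  have compat: "place ks = g \<longleftrightarrow> (\<forall>j<n. g (ks ! j) = h j)" if ks: "ks \<in> orderings n" and g: "g \<in> ?G" for ks g
  proof
    assume "place ks = g"
    then show "\<forall>j<n. g (ks ! j) = h j" using pos[OF ks] by (auto simp: place_def)
  next
    assume *: "\<forall>j<n. g (ks ! j) = h j"
    show "place ks = g"
    proof (rule PiE_ext[OF place[OF ks] g])
      fix i assume "i \<in> {..<n}"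
      then have i: "i < n" by simp
      have "h (inv_into {..<n} ((!) ks) i) = g (ks ! inv_into {..<n} ((!) ks) i)"
        using * pos'(1)[OF ks i] by simp
      then show "place ks i = g i" using i pos'(2)[OF ks i] by (simp add: place_def)
    qed
  qed
  have "(\<Sum>ks\<in>orderings n. t ks * (\<Prod>j<n. x (ks ! j) (h j)))
      = (\<Sum>ks\<in>orderings n. t ks * (\<Prod>i<n. x i (place ks i)))"
    by (rule sum.cong) (simp_all add: prod)
  also have "\<dots> = (\<Sum>g\<in>?G. \<Sum>ks | ks \<in> orderings n \<and> place ks = g. t ks * (\<Prod>i<n. x i (place ks i)))"
    by (rule sum.group[symmetric]) (use place in \<open>auto simp: finite_orderings intro!: finite_PiE\<close>)
  also have "\<dots> = (\<Sum>g\<in>?G. (\<Sum>ks\<in>orderings n. if \<forall>j<n. g (ks ! j) = h j then t ks else 0) * (\<Prod>i<n. x i (g i)))"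
  proof (rule sum.cong)
    fix g assume g: "g \<in> ?G"
    have "(\<Sum>ks | ks \<in> orderings n \<and> place ks = g. t ks * (\<Prod>i<n. x i (place ks i)))
        = (\<Sum>ks | ks \<in> orderings n \<and> place ks = g. t ks) * (\<Prod>i<n. x i (g i))"
      by (simp add: sum_distrib_right)
    also have "(\<Sum>ks | ks \<in> orderings n \<and> place ks = g. t ks)
        = (\<Sum>ks\<in>orderings n. if place ks = g then t ks else 0)"
      by (simp add: sum.inter_filter[OF finite_orderings])
    also have "\<dots> = (\<Sum>ks\<in>orderings n. if \<forall>j<n. g (ks ! j) = h j then t ks else 0)"
      by (rule sum.cong) (simp_all add: compat g)
    finally show "(\<Sum>ks | ks \<in> orderings n \<and> place ks = g. t ks * (\<Prod>i<n. x i (place ks i)))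
      = (\<Sum>ks\<in>orderings n. if \<forall>j<n. g (ks ! j) = h j then t ks else 0) * (\<Prod>i<n. x i (g i))" .
  qed simp
  also have "\<dots> = 0" using zero by simp
  finally show ?thesis .
qed

lemma koszul_sign_cong:
  assumes "\<And>x. x \<in> set (letters w) \<Longrightarrow> p x = q x"
  shows "koszul_sign p w = (koszul_sign q w :: 'k::ring_1)"
proof -
  have "p (letters w ! i) = q (letters w ! i)" if "i < length (letters w)" for i
    using that assms nth_mem by blast
  then have "{(i, j). i < j \<and> j < length (letters w) \<and> letters w ! j < letters w ! i \<and>
        p (letters w ! i) = 1 \<and> p (letters w ! j) = 1}
    = {(i, j). i < j \<and> j < length (letters w) \<and> letters w ! j < letters w ! i \<and>
        q (letters w ! i) = 1 \<and> q (letters w ! j) = 1}"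
    by auto
  then show ?thesis by (simp add: koszul_sign_def)
qed

definition vanishing_coefficients :: "nat \<Rightarrow> nat \<Rightarrow> (nat list \<Rightarrow> 'k::field) \<Rightarrow> bool" where
  "vanishing_coefficients d n c \<longleftrightarrow> (\<forall>p h x. (\<forall>j<n. h j < d) \<longrightarrow>
     (\<Sum>ks\<in>orderings n. koszul_sign p (nested_word ks) * c ks * (\<Prod>j<n. x (ks ! j) (h j))) = 0)"

text \<open>
The equations are indexed by the set \<open>P\<close> of odd variables and by the maps \<open>h\<close> and \<open>g\<close> of
\<open>ordering_product_sum_zero\<close>; their number is exponential in \<open>n\<close>, while there are \<open>n!\<close> unknowns.
\<close>

lemma exists_vanishing_coefficients:
  fixes d :: nat
  obtains n and c :: "nat list \<Rightarrow> 'k::field" where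
    "\<exists>ks\<in>orderings n. c ks \<noteq> 0" "vanishing_coefficients d n c"
proof -
  obtain n where n: "4 * (4 * d ^ 2) ^ n < (fact n :: nat)"
    by (rule exponential_less_fact)
  let ?G = "{..<n} \<rightarrow>\<^sub>E {..<d}"
  let ?E = "Pow {..<2 * n + 2} \<times> ?G \<times> ?G"
  define M :: "nat set \<times> (nat \<Rightarrow> nat) \<times> (nat \<Rightarrow> nat) \<Rightarrow> nat list \<Rightarrow> 'k" where
    "M = (\<lambda>(P, h, g) ks. if \<forall>j<n. g (ks ! j) = h j
      then koszul_sign (\<lambda>i. if i \<in> P then 1 else 0) (nested_word ks) else 0)"
  have fin: "finite ?E" by (auto intro!: finite_PiE)
  have "card ?E = 4 * (4 * d ^ 2) ^ n"
    by (simp add: card_cartesian_product card_Pow card_PiE power_mult_distrib power_add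
        flip: power_mult) (simp add: power_mult power2_eq_square power_mult_distrib)
  then have less: "card ?E < card (orderings n)" using n by (simp only: card_orderings)
  obtain c where c: "\<exists>ks\<in>orderings n. c ks \<noteq> 0"
      "\<And>e. e \<in> ?E \<Longrightarrow> (\<Sum>ks\<in>orderings n. M e ks * c ks) = 0"
    using underdetermined_system_has_solution[OF fin finite_orderings less, of M] by blast
  have "(\<Sum>ks\<in>orderings n. koszul_sign p (nested_word ks) * c ks * (\<Prod>j<n. x (ks ! j) (h j))) = 0"
    if h: "\<forall>j<n. h j < d" for p h and x :: "nat \<Rightarrow> nat \<Rightarrow> 'k"
  proof (rule ordering_product_sum_zero[where d = d])
    fix g assume g: "g \<in> ?G"
    let ?P = "{i \<in> {..<2 * n + 2}. p i = 1}"
    have k: "koszul_sign p (nested_word ks) = (koszul_sign (\<lambda>i. if i \<in> ?P then 1 else 0) (nested_word ks) :: 'k)"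
      if "ks \<in> orderings n" for ks
      by (rule koszul_sign_cong) (auto simp: set_letters_ordering[OF that])
    have "(?P, restrict h {..<n}, g) \<in> ?E" using h g by auto
    from c(2)[OF this]
    have "0 = (\<Sum>ks\<in>orderings n. M (?P, restrict h {..<n}, g) ks * c ks)" by simp
    also have "\<dots> = (\<Sum>ks\<in>orderings n. if \<forall>j<n. g (ks ! j) = h j
        then koszul_sign p (nested_word ks) * c ks else 0)"
      by (rule sum.cong) (auto simp: M_def k)
    finally show "(\<Sum>ks\<in>orderings n. if \<forall>j<n. g (ks ! j) = h j
        then koszul_sign p (nested_word ks) * c ks else 0) = 0" by simp
  qed (use h in blast)
  then show ?thesis using that[OF c(1)] unfolding vanishing_coefficients_def by blast
qed

section \<open>Quotients of the free superalgebra\<close>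

text \<open>
Unlike \<open>graded_ideal\<close>, this notion is visibly stable under intersections.
\<close>

definition two_sided_ideal :: "'a set \<Rightarrow> ('k::field, 'a, 'm) module_scheme \<Rightarrow> bool" where
  "two_sided_ideal J A \<longleftrightarrow> J \<subseteq> carrier A \<and> \<zero>\<^bsub>A\<^esub> \<in> J \<and> (\<forall>x\<in>J. \<forall>y\<in>J. x \<oplus>\<^bsub>A\<^esub> y \<in> J) \<and>
    (\<forall>c. \<forall>x\<in>J. c \<odot>\<^bsub>A\<^esub> x \<in> J) \<and>
    (\<forall>x\<in>carrier A. \<forall>y\<in>J. x \<otimes>\<^bsub>A\<^esub> y \<in> J \<and> y \<otimes>\<^bsub>A\<^esub> x \<in> J)"

lemma graded_ideal_two_sided:
  fixes A :: "('k::field, 'a, 'm) superalgebra_scheme"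
  shows "graded_ideal J A \<Longrightarrow> two_sided_ideal J A"
  unfolding graded_ideal_def two_sided_ideal_def
proof (elim conjE, intro conjI)
  assume s: "submodule J (ring_of_type_algebra :: 'k ring) A"
  interpret submodule J "ring_of_type_algebra :: 'k ring" A by (rule s)
  show "J \<subseteq> carrier A" using subset by simp
  show "\<zero>\<^bsub>A\<^esub> \<in> J" using one_closed by simp
  show "\<forall>x\<in>J. \<forall>y\<in>J. x \<oplus>\<^bsub>A\<^esub> y \<in> J" using m_closed by simp
  show "\<forall>c. \<forall>x\<in>J. c \<odot>\<^bsub>A\<^esub> x \<in> J" using smult_closed by (simp add: ring_of_type_algebra_def)
qed

lemma two_sided_ideal_Inter:
  "\<lbrakk>\<J> \<noteq> {}; \<And>J. J \<in> \<J> \<Longrightarrow> two_sided_ideal J A\<rbrakk> \<Longrightarrow> two_sided_ideal (\<Inter>\<J>) A"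
  unfolding two_sided_ideal_def by (intro conjI ballI allI InterI) (blast+)

definition free_carrier :: "'x set \<Rightarrow> ('x monomial \<Rightarrow> 'k::field) set" where
  "free_carrier I = {f. finite {w. f w \<noteq> 0} \<and> (\<forall>w. f w \<noteq> 0 \<longrightarrow> set (letters w) \<subseteq> I)}"

definition free_mul :: "('x monomial \<Rightarrow> 'k::field) \<Rightarrow> ('x monomial \<Rightarrow> 'k) \<Rightarrow> 'x monomial \<Rightarrow> 'k" where
  "free_mul f g w = (case w of Var x \<Rightarrow> 0 | Prod u v \<Rightarrow> f u * g v)"

lemma free_mul_simps [simp]: "free_mul f g (Var x) = 0" "free_mul f g (Prod u v) = f u * g v"
  by (simp_all add: free_mul_def)

lemma free_superalgebra_simps:
  fixes I :: "'x set" and p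
  defines "F \<equiv> free_nonassoc_superalgebra I p :: ('k::field, 'x monomial \<Rightarrow> 'k) superalgebra"
  shows "carrier F = free_carrier I" "monoid.mult F = free_mul" "zero F = 0" "add F = (+)"
    "module.smult F = (\<lambda>c f w. c * f w)"
  unfolding F_def
  by (auto simp: free_nonassoc_superalgebra_def free_carrier_def free_mul_def fun_eq_iff)

lemma free_carrier_add: "f \<in> free_carrier I \<Longrightarrow> g \<in> free_carrier I \<Longrightarrow> f + g \<in> free_carrier I"
proof -
  assume f: "f \<in> free_carrier I" and g: "g \<in> free_carrier I"
  have "finite {w. (f + g) w \<noteq> 0}"
    by (rule finite_subset[of _ "{w. f w \<noteq> 0} \<union> {w. g w \<noteq> 0}"])
      (use f g in \<open>auto simp: free_carrier_def\<close>)
  moreover have "set (letters w) \<subseteq> I" if "(f + g) w \<noteq> 0" for w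
  proof -
    have "f w \<noteq> 0 \<or> g w \<noteq> 0" using that by auto
    then show ?thesis using f g unfolding free_carrier_def by blast
  qed
  ultimately show ?thesis unfolding free_carrier_def by blast
qed

lemma free_carrier_scale: "f \<in> free_carrier I \<Longrightarrow> (\<lambda>w. c * f w) \<in> free_carrier I"
proof -
  assume f: "f \<in> free_carrier I"
  have "finite {w. c * f w \<noteq> 0}"
    by (rule finite_subset[of _ "{w. f w \<noteq> 0}"]) (use f in \<open>auto simp: free_carrier_def\<close>)
  then show ?thesis using f by (auto simp: free_carrier_def)
qed

lemma free_carrier_mul: "f \<in> free_carrier I \<Longrightarrow> g \<in> free_carrier I \<Longrightarrow> free_mul f g \<in> free_carrier I"
proof -
  assume f: "f \<in> free_carrier I" and g: "g \<in> free_carrier I"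
  have *: "\<exists>u v. w = Prod u v \<and> f u \<noteq> 0 \<and> g v \<noteq> 0" if "free_mul f g w \<noteq> 0" for w
    using that by (cases w) auto
  have "finite {w. free_mul f g w \<noteq> 0}"
  proof (rule finite_subset)
    show "{w. free_mul f g w \<noteq> 0} \<subseteq> (\<lambda>(u, v). Prod u v) ` ({w. f w \<noteq> 0} \<times> {w. g w \<noteq> 0})"
      using * by fastforce
    show "finite ((\<lambda>(u, v). Prod u v) ` ({w. f w \<noteq> 0} \<times> {w. g w \<noteq> 0}))"
      using f g by (simp add: free_carrier_def)
  qed
  moreover have "set (letters w) \<subseteq> I" if nz: "free_mul f g w \<noteq> 0" for w
  proof -
    obtain u v where w: "w = Prod u v" "f u \<noteq> 0" "g v \<noteq> 0" using *[OF nz] by blast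
    then have "set (letters u) \<subseteq> I" "set (letters v) \<subseteq> I"
      using f g unfolding free_carrier_def by blast+
    then show ?thesis using w by simp
  qed
  ultimately show ?thesis unfolding free_carrier_def by blast
qed

text \<open>
The product of cosets is well defined because \<open>u v - x y = (u - x) v + x (v - y)\<close> and the ideal
absorbs factors on both sides.
\<close>

lemma algebra_image_quotient:
  fixes I :: "'x set" and p
  defines "F \<equiv> free_nonassoc_superalgebra I p :: ('k::field, 'x monomial \<Rightarrow> 'k) superalgebra"
  assumes J: "two_sided_ideal J F"
  shows "algebra_image (\<lambda>c f w. c * f w) (free_carrier I) free_mul (\<lambda>x. J +>\<^bsub>F\<^esub> x)
    (quotient_superalgebra F J)"
    and "x \<in> J \<Longrightarrow> J +>\<^bsub>F\<^esub> x = J"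
    and "J +>\<^bsub>F\<^esub> x = J \<Longrightarrow> x \<in> J"
proof -
  note F = free_superalgebra_simps[of I p, where 'k = 'k, folded F_def]
  have sub: "J \<subseteq> free_carrier I" and zero: "0 \<in> J" and add: "\<And>x y. \<lbrakk>x \<in> J; y \<in> J\<rbrakk> \<Longrightarrow> x + y \<in> J"
    and scl: "\<And>x c. x \<in> J \<Longrightarrow> (\<lambda>w. c * x w) \<in> J"
    and mulr: "\<And>x y. \<lbrakk>x \<in> free_carrier I; y \<in> J\<rbrakk> \<Longrightarrow> free_mul x y \<in> J"
    and mull: "\<And>x y. \<lbrakk>x \<in> free_carrier I; y \<in> J\<rbrakk> \<Longrightarrow> free_mul y x \<in> J"
    using J unfolding two_sided_ideal_def F by blast+
  have neg: "- x \<in> J" if "x \<in> J" for x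
    using scl[OF that, of "- 1"] by (simp add: fun_Compl_def)
  have diff: "x - y \<in> J" if "x \<in> J" "y \<in> J" for x y
    using add[OF that(1) neg[OF that(2)]] by simp
  have coset: "J +>\<^bsub>F\<^esub> x = (\<lambda>j. j + x) ` J" for x
    by (auto simp: a_r_coset_def' F)
  have mem: "a \<in> J +>\<^bsub>F\<^esub> x \<longleftrightarrow> a - x \<in> J" for a x
    unfolding coset by (metis (no_types, lifting) add_diff_cancel_right' diff_add_cancel image_iff)
  have cong: "J +>\<^bsub>F\<^esub> x = J +>\<^bsub>F\<^esub> y" if "x - y \<in> J" for x y
  proof -
    have "a - x \<in> J \<longleftrightarrow> a - y \<in> J" for a
      using add[of "a - x" "x - y"] diff[of "a - y" "x - y"] that by auto
    then show ?thesis by (intro Set.set_eqI) (simp add: mem)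
  qed
  have refl: "x \<in> J +>\<^bsub>F\<^esub> x" for x by (simp add: mem zero)
  show JJ: "J +>\<^bsub>F\<^esub> x = J" if "x \<in> J" for x
    using cong[of x 0] that by (simp add: coset)
  show "x \<in> J" if "J +>\<^bsub>F\<^esub> x = J" for x
    using refl[of x] that by simp
  have car: "a \<in> free_carrier I" if "a \<in> J +>\<^bsub>F\<^esub> x" "x \<in> free_carrier I" for a x
    using free_carrier_add[of "a - x" I x] that sub mem by auto
  have union: "(\<Union>a\<in>S. J +>\<^bsub>F\<^esub> t a) = J +>\<^bsub>F\<^esub> y"
    if "S \<noteq> {}" "\<And>a. a \<in> S \<Longrightarrow> t a - y \<in> J" for S :: "'z set" and t y
    using that cong[of "t _" y] by auto
  show "algebra_image (\<lambda>c f w. c * f w) (free_carrier I) free_mul (\<lambda>x. J +>\<^bsub>F\<^esub> x)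
    (quotient_superalgebra F J)"
  proof unfold_locales
    fix a b :: 'k and x y z :: "'x monomial \<Rightarrow> 'k"
    show "(\<lambda>w. a * (x + y) w) = (\<lambda>w. a * x w) + (\<lambda>w. a * y w)"
      "(\<lambda>w. (a + b) * x w) = (\<lambda>w. a * x w) + (\<lambda>w. b * x w)"
      "(\<lambda>w. a * (b * x w)) = (\<lambda>w. a * b * x w)" "(\<lambda>w. 1 * x w) = x"
      by (auto simp: fun_eq_iff algebra_simps)
    show "(0 :: 'x monomial \<Rightarrow> 'k) \<in> free_carrier I" by (rule subsetD[OF sub zero])
    show "free_mul (x + y) z = free_mul x z + free_mul y z"
      "free_mul x (y + z) = free_mul x y + free_mul x z"
      "free_mul (\<lambda>w. a * x w) y = (\<lambda>w. a * free_mul x y w)"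
      "free_mul x (\<lambda>w. a * y w) = (\<lambda>w. a * free_mul x y w)"
      by (auto simp: free_mul_def fun_eq_iff algebra_simps split: monomial.split)
    assume x: "x \<in> free_carrier I"
    then show "(\<lambda>w. a * x w) \<in> free_carrier I" by (rule free_carrier_scale)
    show "a \<odot>\<^bsub>quotient_superalgebra F J\<^esub> (J +>\<^bsub>F\<^esub> x) = J +>\<^bsub>F\<^esub> (\<lambda>w. a * x w)"
    proof -
      have "(\<lambda>w. a * u w) - (\<lambda>w. a * x w) \<in> J" if "u \<in> J +>\<^bsub>F\<^esub> x" for u
        using scl[of "u - x" a] that by (simp add: mem fun_diff_def right_diff_distrib)
      then show ?thesis
        using refl[of x] by (auto simp: quotient_superalgebra_def F intro!: union)
    qed
    assume y: "y \<in> free_carrier I"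
    show "x + y \<in> free_carrier I" "free_mul x y \<in> free_carrier I"
      using x y by (rule free_carrier_add, rule free_carrier_mul)
    show "(J +>\<^bsub>F\<^esub> x) \<oplus>\<^bsub>quotient_superalgebra F J\<^esub> (J +>\<^bsub>F\<^esub> y) = J +>\<^bsub>F\<^esub> (x + y)"
    proof -
      have "(J +>\<^bsub>F\<^esub> x) <+>\<^bsub>F\<^esub> (J +>\<^bsub>F\<^esub> y) = J +>\<^bsub>F\<^esub> (x + y)"
      proof (intro Set.set_eqI iffI)
        fix s assume "s \<in> (J +>\<^bsub>F\<^esub> x) <+>\<^bsub>F\<^esub> (J +>\<^bsub>F\<^esub> y)"
        then obtain u v where "u - x \<in> J" "v - y \<in> J" "s = u + v"
          by (auto simp: set_add_def' mem F)
        then show "s \<in> J +>\<^bsub>F\<^esub> (x + y)" using add[of "u - x" "v - y"] by (simp add: mem algebra_simps)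
      next
        fix s assume "s \<in> J +>\<^bsub>F\<^esub> (x + y)"
        then have "s - y \<in> J +>\<^bsub>F\<^esub> x" by (simp add: mem algebra_simps)
        moreover have "s = (s - y) + y" by simp
        ultimately show "s \<in> (J +>\<^bsub>F\<^esub> x) <+>\<^bsub>F\<^esub> (J +>\<^bsub>F\<^esub> y)"
          using refl[of y] unfolding set_add_def' F by blast
      qed
      then show ?thesis by (simp add: quotient_superalgebra_def FactRing_def)
    qed
    show "(J +>\<^bsub>F\<^esub> x) \<otimes>\<^bsub>quotient_superalgebra F J\<^esub> (J +>\<^bsub>F\<^esub> y) = J +>\<^bsub>F\<^esub> (free_mul x y)"
    proof -
      have "free_mul u v - free_mul x y \<in> J" if u: "u \<in> J +>\<^bsub>F\<^esub> x" and v: "v \<in> J +>\<^bsub>F\<^esub> y" for u v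
      proof -
        have "free_mul u v - free_mul x y = free_mul (u - x) v + free_mul x (v - y)"
          by (auto simp: free_mul_def fun_eq_iff algebra_simps split: monomial.split)
        moreover have "free_mul (u - x) v \<in> J" using u car[OF v y] by (simp add: mem mull)
        moreover have "free_mul x (v - y) \<in> J" using v x by (simp add: mem mulr)
        ultimately show ?thesis using add by simp
      qed
      then have "(\<Union>u\<in>J +>\<^bsub>F\<^esub> x. \<Union>v\<in>J +>\<^bsub>F\<^esub> y. J +>\<^bsub>F\<^esub> free_mul u v)
          = (\<Union>u\<in>J +>\<^bsub>F\<^esub> x. J +>\<^bsub>F\<^esub> free_mul x y)"
        using refl[of y] by (intro SUP_cong refl union) auto
      also have "\<dots> = J +>\<^bsub>F\<^esub> free_mul x y" using refl[of x] by auto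
      finally show ?thesis
        by (simp add: quotient_superalgebra_def FactRing_def rcoset_mult_def F)
    qed
  next
    show "carrier (quotient_superalgebra F J) = (\<lambda>x. J +>\<^bsub>F\<^esub> x) ` free_carrier I"
      by (auto simp: quotient_superalgebra_def FactRing_def A_RCOSETS_def' F)
    show "\<zero>\<^bsub>quotient_superalgebra F J\<^esub> = J +>\<^bsub>F\<^esub> 0"
      by (simp add: quotient_superalgebra_def FactRing_def JJ zero)
  qed
qed

section \<open>Metabelianity of the free superalgebra\<close>

context nonassoc_algebra
begin

lemma zero_mult: "x \<in> carrier A \<Longrightarrow> \<zero> \<otimes> x = \<zero>" "x \<in> carrier A \<Longrightarrow> x \<otimes> \<zero> = \<zero>"
  using mult_smult_left[of "\<zero>" x 0] mult_smult_right[of x "\<zero>" 0] smult_l_null mult_closed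
  by (simp_all add: ring_of_type_algebra_def)

lemma smult_sign_cancel:
  assumes "x \<in> carrier A" "c * c = 1" "c \<odot> x = \<zero>"
  shows "x = \<zero>"
proof -
  have "x = (c * c) \<odot> x" using assms smult_one by (simp add: ring_of_type_algebra_def)
  also have "\<dots> = c \<odot> (c \<odot> x)"
    using smult_assoc1[of c c x] assms(1) by (simp add: ring_of_type_algebra_def)
  also have "\<dots> = \<zero>" unfolding assms(3) using smult_r_null[of c] by (simp add: ring_of_type_algebra_def)
  finally show ?thesis .
qed

end

context superalgebra
begin

text \<open>
The element \<open>e\<^sub>S \<otimes> a\<close> of the Grassmann envelope.
\<close>

definition single :: "nat set \<Rightarrow> 'a \<Rightarrow> nat set \<Rightarrow> 'a" where
  "single S a T = (if T = S then a else \<zero>)"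

lemma smult_carrier: "x \<in> carrier A \<Longrightarrow> c \<odot> x \<in> carrier A"
  using smult_closed[of c x] by (simp add: ring_of_type_algebra_def)

lemma single_mult:
  assumes "finite S" "finite T" "S \<inter> T = {}" "a \<in> carrier A" "b \<in> carrier A"
  shows "single S a \<otimes>\<^bsub>grassmann_envelope A\<^esub> single T b
    = single (S \<union> T) (grassmann_sign S T \<odot> (a \<otimes> b))"
proof
  fix U
  let ?v = "grassmann_sign S T \<odot> (a \<otimes> b)"
  have v: "?v \<in> carrier A" using assms by (simp add: smult_carrier mult_closed)
  have null: "c \<odot> \<zero> = \<zero>" for c
    using smult_r_null[of c] by (simp add: ring_of_type_algebra_def)
  have summand: "grassmann_sign R (U - R) \<odot> (single S a R \<otimes> single T b (U - R))
      = (if S = R then if U = S \<union> T then ?v else \<zero> else \<zero>)" if "R \<subseteq> U" for R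
  proof -
    have "R = S \<Longrightarrow> U - R = T \<longleftrightarrow> U = S \<union> T" using that assms(3) by blast
    then show ?thesis
      using assms by (cases "R = S") (auto simp: single_def zero_mult null)
  qed
  show "(single S a \<otimes>\<^bsub>grassmann_envelope A\<^esub> single T b) U = single (S \<union> T) ?v U"
  proof (cases "finite U")
    case True
    have "(\<Oplus>R\<in>Pow U. grassmann_sign R (U - R) \<odot> (single S a R \<otimes> single T b (U - R)))
        = (\<Oplus>R\<in>Pow U. if S = R then if U = S \<union> T then ?v else \<zero> else \<zero>)"
      by (rule M.finsum_cong') (auto simp: summand v)
    also have "\<dots> = single (S \<union> T) ?v U"
    proof (cases "U = S \<union> T")
      case eq: True
      have "(\<Oplus>R\<in>Pow U. if S = R then ?v else \<zero>) = ?v"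
        by (rule M.finsum_singleton[where f = "\<lambda>_. ?v"]) (use eq True v in auto)
      then show ?thesis using eq by (simp add: single_def)
    next
      case False
      then show ?thesis by (simp add: single_def)
    qed
    finally show ?thesis using True by (simp add: grassmann_envelope_def)
  next
    case False
    then show ?thesis using assms by (auto simp: grassmann_envelope_def single_def)
  qed
qed

lemma part_carrier: "x \<in> part A i \<Longrightarrow> x \<in> carrier A"
  using submoduleE(1)[OF part_submodule] by blast

lemma zero_part: "\<zero> \<in> part A i"
proof -
  interpret P: submodule "part A i" "ring_of_type_algebra :: 'k ring" A by (rule part_submodule)
  show ?thesis using P.one_closed by simp
qed

lemma single_in_envelope:
  assumes "finite S" "of_nat (card S) = i" "a \<in> part A i"
  shows "single S a \<in> carrier (grassmann_envelope A)"
proof -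
  have "finite {T. single S a T \<noteq> \<zero>}"
    by (rule finite_subset[of _ "{S}"]) (auto simp: single_def)
  then show ?thesis
    using assms zero_part by (auto simp: grassmann_envelope_def single_def)
qed

text \<open>
Homogeneous elements are lifted to the Grassmann envelope with pairwise disjoint index sets, where
the product of the lifts is, up to a sign, \<open>e\<^sub>U\<close> times the product of the elements.
\<close>

lemma homogeneous_metabelian:
  assumes V: "grassmann_envelope A \<in> V_eps \<epsilon>"
    and "a \<in> part A i" "b \<in> part A j" "c \<in> part A k" "d \<in> part A l"
  shows "(a \<otimes> b) \<otimes> (c \<otimes> d) = \<zero>"
proof -
  define S where "S m i = (if i = (1::bit) then {m} else {})" for m :: nat and i
  have S: "finite (S m i)" "of_nat (card (S m i)) = i" for m i
    by (cases i) (auto simp: S_def)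
  have disj: "S m i \<inter> S m' i' = {}" if "m \<noteq> m'" for m m' i i'
    using that by (auto simp: S_def)
  note car = assms(2-5)[THEN part_carrier]
  let ?G = "grassmann_envelope A"
  let ?s = "grassmann_sign (S 0 i) (S 1 j) :: 'k" and ?t = "grassmann_sign (S 2 k) (S 3 l) :: 'k"
    and ?r = "grassmann_sign (S 0 i \<union> S 1 j) (S 2 k \<union> S 3 l) :: 'k"
  have "(single (S 0 i) a \<otimes>\<^bsub>?G\<^esub> single (S 1 j) b) \<otimes>\<^bsub>?G\<^esub> (single (S 2 k) c \<otimes>\<^bsub>?G\<^esub> single (S 3 l) d) = \<zero>\<^bsub>?G\<^esub>"
    using V assms(2-5) S single_in_envelope unfolding V_eps_def by blast
  moreover have "(S 0 i \<union> S 1 j) \<inter> (S 2 k \<union> S 3 l) = {}" by (auto simp: S_def)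
  ultimately have "single (S 0 i \<union> S 1 j \<union> (S 2 k \<union> S 3 l))
      (?r \<odot> ((?s \<odot> (a \<otimes> b)) \<otimes> (?t \<odot> (c \<otimes> d)))) = \<zero>\<^bsub>?G\<^esub>"
    using car S by (simp add: single_mult disj mult_closed smult_carrier)
  from fun_cong[OF this, of "S 0 i \<union> S 1 j \<union> (S 2 k \<union> S 3 l)"]
  have "?r \<odot> ((?s \<odot> (a \<otimes> b)) \<otimes> (?t \<odot> (c \<otimes> d))) = \<zero>"
    by (simp add: single_def grassmann_envelope_def)
  then have "?r \<odot> (?t \<odot> (?s \<odot> ((a \<otimes> b) \<otimes> (c \<otimes> d)))) = \<zero>"
    using car by (simp add: mult_smult_left mult_smult_right mult_closed smult_carrier)
  moreover have "grassmann_sign P R * grassmann_sign P R = (1 :: 'k)" for P R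
    using grassmann_sign_cases[of P R, where 'k = 'k] by auto
  ultimately show ?thesis
    using car smult_sign_cancel mult_closed smult_carrier by meson
qed

end

definition basis_word :: "'x monomial \<Rightarrow> 'x monomial \<Rightarrow> 'k::field" where
  "basis_word w v = (if v = w then 1 else 0)"

lemma free_mul_basis_word: "free_mul (basis_word u) (basis_word v) = basis_word (Prod u v)"
  by (auto simp: fun_eq_iff free_mul_def basis_word_def split: monomial.split)

lemma basis_word_carrier: "set (letters w) \<subseteq> I \<Longrightarrow> basis_word w \<in> free_carrier I"
  by (simp add: free_carrier_def basis_word_def)

lemma basis_word_part:
  "set (letters w) \<subseteq> I \<Longrightarrow>
    basis_word w \<in> part (free_nonassoc_superalgebra I p) (sum_list (map p (letters w)))"
  by (simp add: free_nonassoc_superalgebra_def basis_word_def)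

lemma free_part_carrier: "f \<in> part (free_nonassoc_superalgebra I p) i \<Longrightarrow> f \<in> free_carrier I"
  by (auto simp: free_nonassoc_superalgebra_def free_carrier_def)

lemma basis_word_expansion:
  assumes "finite {w. f w \<noteq> 0}"
  shows "f = (\<Sum>w | f w \<noteq> 0. (\<lambda>v. f w * basis_word w v))"
proof
  fix v
  have "(\<Sum>w | f w \<noteq> 0. f w * basis_word w v) = (\<Sum>w | f w \<noteq> 0. if v = w then f v else 0)"
    by (rule sum.cong) (auto simp: basis_word_def)
  also have "\<dots> = f v" using assms by simp
  finally show "f v = (\<Sum>w | f w \<noteq> 0. (\<lambda>v. f w * basis_word w v)) v"
    by (simp add: sum_fun_apply)
qed

text \<open>
Metabelianity of the quotient by \<open>J\<close>, stated for words only: words are homogeneous, and by linearity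
they suffice (\<open>metabelian_ideal_contains\<close>).
\<close>

definition metabelian_ideal :: "'x set \<Rightarrow> ('x monomial \<Rightarrow> 'k::field) set \<Rightarrow> bool" where
  "metabelian_ideal I J \<longleftrightarrow> (\<forall>u v u' v'. set (letters (Prod (Prod u v) (Prod u' v'))) \<subseteq> I \<longrightarrow>
     basis_word (Prod (Prod u v) (Prod u' v')) \<in> J)"

lemma metabelian_ideal_if_quotient_in_V_eps:
  fixes I :: "'x set" and p and \<epsilon> :: "'k::field"
  defines "F \<equiv> free_nonassoc_superalgebra I p :: ('k, 'x monomial \<Rightarrow> 'k) superalgebra"
  assumes J: "graded_ideal J F" and Q: "quotient_superalgebra F J \<in> super_class (V_eps \<epsilon>)"
  shows "metabelian_ideal I J"
  unfolding metabelian_ideal_def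
proof (intro allI impI)
  fix u v u' v'
  assume l: "set (letters (Prod (Prod u v) (Prod u' v'))) \<subseteq> I"
  let ?Q = "quotient_superalgebra F J"
  have ideal: "two_sided_ideal J F" using J by (rule graded_ideal_two_sided)
  note quot = algebra_image_quotient[of J I p, folded F_def, OF ideal]
  interpret A: algebra_image "\<lambda>c f w. c * f w" "free_carrier I" free_mul "\<lambda>x. J +>\<^bsub>F\<^esub> x" ?Q
    by (rule quot)
  interpret Q: superalgebra ?Q using Q by (simp add: super_class_def)
  have hom: "J +>\<^bsub>F\<^esub> basis_word w \<in> part ?Q (sum_list (map p (letters w)))"
    if "set (letters w) \<subseteq> I" for w
    using basis_word_part[OF that, of p] by (auto simp: quotient_superalgebra_def F_def)
  let ?C = "free_carrier I :: ('x monomial \<Rightarrow> 'k) set"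
  have c: "basis_word u \<in> ?C" "basis_word v \<in> ?C" "basis_word u' \<in> ?C" "basis_word v' \<in> ?C"
    using l by (auto intro!: basis_word_carrier)
  have V: "grassmann_envelope ?Q \<in> V_eps \<epsilon>" using Q by (simp add: super_class_def)
  have "((J +>\<^bsub>F\<^esub> basis_word u) \<otimes>\<^bsub>?Q\<^esub> (J +>\<^bsub>F\<^esub> basis_word v)) \<otimes>\<^bsub>?Q\<^esub>
      ((J +>\<^bsub>F\<^esub> basis_word u') \<otimes>\<^bsub>?Q\<^esub> (J +>\<^bsub>F\<^esub> basis_word v')) = \<zero>\<^bsub>?Q\<^esub>"
    by (rule Q.homogeneous_metabelian[OF V hom hom hom hom]) (use l in auto)
  then have "J +>\<^bsub>F\<^esub> basis_word (Prod (Prod u v) (Prod u' v')) = \<zero>\<^bsub>?Q\<^esub>"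
    using c by (simp add: A.mult_A A.mul_C flip: free_mul_basis_word)
  then show "basis_word (Prod (Prod u v) (Prod u' v')) \<in> J"
    using quot(3) by (simp add: quotient_superalgebra_def FactRing_def)
qed

primrec contains_double_product :: "'x monomial \<Rightarrow> bool" where
  "contains_double_product (Var x) = False"
| "contains_double_product (Prod u v) = (contains_double_product u \<or> contains_double_product v \<or>
     (\<exists>a b c d. u = Prod a b \<and> v = Prod c d))"

lemma metabelian_ideal_contains:
  fixes I :: "'x set" and p
  defines "F \<equiv> free_nonassoc_superalgebra I p :: ('k::field, 'x monomial \<Rightarrow> 'k) superalgebra"
  assumes J: "two_sided_ideal J F" and met: "metabelian_ideal I J"
    and f: "f \<in> free_carrier I" "\<And>w. f w \<noteq> 0 \<Longrightarrow> contains_double_product w"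
  shows "f \<in> J"
proof -
  note F = free_superalgebra_simps[of I p, where 'k = 'k, folded F_def]
  have zero: "0 \<in> J" and add: "\<And>x y. \<lbrakk>x \<in> J; y \<in> J\<rbrakk> \<Longrightarrow> x + y \<in> J"
    and scl: "\<And>x c. x \<in> J \<Longrightarrow> (\<lambda>w. c * x w) \<in> J"
    and mulr: "\<And>x y. \<lbrakk>x \<in> free_carrier I; y \<in> J\<rbrakk> \<Longrightarrow> free_mul x y \<in> J"
    and mull: "\<And>x y. \<lbrakk>x \<in> free_carrier I; y \<in> J\<rbrakk> \<Longrightarrow> free_mul y x \<in> J"
    using J unfolding two_sided_ideal_def F by blast+
  have basis: "basis_word w \<in> J" if "contains_double_product w" "set (letters w) \<subseteq> I" for w
    using that
  proof (induction w)
    case (Prod u v)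
    then have c: "basis_word u \<in> (free_carrier I :: ('x monomial \<Rightarrow> 'k) set)"
      "basis_word v \<in> (free_carrier I :: ('x monomial \<Rightarrow> 'k) set)"
      by (auto intro!: basis_word_carrier)
    from Prod.prems(1) consider "contains_double_product u" | "contains_double_product v"
      | a b c d where "u = Prod a b" "v = Prod c d" by auto
    then show ?case
    proof cases
      case 1
      then have "free_mul (basis_word u) (basis_word v) \<in> J" using Prod c by (intro mull) auto
      then show ?thesis by (simp add: free_mul_basis_word)
    next
      case 2
      then have "free_mul (basis_word u) (basis_word v) \<in> J" using Prod c by (intro mulr) auto
      then show ?thesis by (simp add: free_mul_basis_word)
    next
      case 3
      then show ?thesis using met Prod.prems(2) unfolding metabelian_ideal_def by blast
    qed
  qed simp
  have "(\<Sum>w\<in>W. (\<lambda>v. f w * basis_word w v)) \<in> J" if "W \<subseteq> {w. f w \<noteq> 0}" for W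
    using that
  proof (induction W rule: infinite_finite_induct)
    case (insert w W)
    have "set (letters w) \<subseteq> I" using insert.prems f(1) unfolding free_carrier_def by blast
    moreover have "contains_double_product w" using insert.prems f(2) by blast
    ultimately have "(\<lambda>v. f w * basis_word w v) \<in> J" by (intro scl basis)
    moreover have "(\<Sum>w\<in>W. (\<lambda>v. f w * basis_word w v)) \<in> J" using insert by blast
    ultimately show ?case unfolding sum.insert[OF insert.hyps] by (rule add)
  qed (simp_all add: zero)
  then have "(\<Sum>w | f w \<noteq> 0. (\<lambda>v. f w * basis_word w v)) \<in> J" by blast
  then show ?thesis
    using basis_word_expansion[of f] f(1) by (simp add: free_carrier_def)
qed

section \<open>Superidentities of the free superalgebra\<close>

text \<open>
The coefficient of \<open>w\<close> in a product is the product of coefficients of the two factors of \<open>w\<close>, so a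
nested word contributes only to words \<open>w\<close> that start with the same pattern of brackets. If no two
proper products are multiplied in \<open>w\<close>, then the subwords of \<open>w\<close> in the places of the \<open>y\<close> and \<open>z\<close>
are generators, since they are multiplied by proper products; \<open>h\<close> lists those in the places of
the \<open>y\<close>. The constant \<open>C\<close> collects the coefficients of \<open>x\<^sub>0, x\<^sub>1\<close> and the \<open>z\<^sub>j\<close>, which do not depend on
the ordering.
\<close>

lemma nested_word_coefficient:
  fixes x :: "nat \<Rightarrow> 'x monomial \<Rightarrow> 'k::field"
  assumes "\<not> contains_double_product w"
  shows "\<exists>C h. \<forall>ks. length ks = n \<longrightarrow> monomial_value free_mul x (nested_word ks) w
    = C * (\<Prod>j<n. x (2 * (ks ! j) + 2) (Var (h j)))"
  using assms
proof (induction n arbitrary: w)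
  case 0
  show ?case by (intro exI[of _ "free_mul (x 0) (x 1) w"]) simp
next
  case (Suc n)
  show ?case
  proof (cases "\<exists>g P q. w = Prod (Prod (Var g) P) (Var q)")
    case True
    then obtain g P q where w: "w = Prod (Prod (Var g) P) (Var q)" by blast
    then obtain C h where IH: "\<And>ks. length ks = n \<Longrightarrow> monomial_value free_mul x (nested_word ks) P
        = C * (\<Prod>j<n. x (2 * (ks ! j) + 2) (Var (h j)))"
      using Suc.IH[of P] Suc.prems by auto
    show ?thesis
    proof (intro exI allI impI)
      fix ks :: "nat list" assume "length ks = Suc n"
      then obtain k ks' where ks: "ks = k # ks'" "length ks' = n" by (auto simp: length_Suc_conv)
      show "monomial_value free_mul x (nested_word ks) w = C * x (2 * n + 3) (Var q)
          * (\<Prod>j<Suc n. x (2 * (ks ! j) + 2) (Var (case j of 0 \<Rightarrow> g | Suc j \<Rightarrow> h j)))"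
        by (simp add: w ks IH prod.lessThan_Suc_shift del: prod.lessThan_Suc)
    qed
  next
    case False
    have "monomial_value free_mul x (nested_word ks) w = 0" if "length ks = Suc n" for ks
    proof -
      obtain k ks' where ks: "ks = k # ks'" using \<open>length ks = Suc n\<close> by (auto simp: length_Suc_conv)
      have nested_Var: "monomial_value free_mul x (nested_word ks') (Var q) = 0" for q
        by (cases ks') simp_all
      show ?thesis
      proof (cases w)
        case (Prod a b)
        show ?thesis
        proof (cases a)
          case a: (Prod a1 a2)
          then obtain q where b: "b = Var q" using Prod Suc.prems by (cases b) auto
          then obtain b1 b2 where "a1 = Prod b1 b2" using False Prod a by (cases a1) auto
          then obtain q' where "a2 = Var q'" using Prod a Suc.prems by (cases a2) auto
          then show ?thesis by (simp add: ks Prod a nested_Var)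
        qed (simp add: ks Prod)
      qed (simp add: ks)
    qed
    then show ?thesis by (intro exI[of _ 0]) simp
  qed
qed

text \<open>
Lifting the arguments to the free nonassociative superalgebra gives a value whose coefficients at
words outside the metabelian ideal vanish by the choice of \<open>c\<close>.
\<close>

lemma quotient_satisfies_superidentity:
  fixes d :: nat and p and c :: "nat list \<Rightarrow> 'k::field"
  defines "F \<equiv> free_nonassoc_superalgebra {..<d} p :: ('k, nat monomial \<Rightarrow> 'k) superalgebra"
  assumes J: "two_sided_ideal J F" and met: "metabelian_ideal {..<d} J"
    and c: "vanishing_coefficients d n c"
  shows "satisfies_superidentity (quotient_superalgebra F J) (word_poly n c)"
  unfolding satisfies_superidentity_def
proof (intro allI impI)
  fix q :: "nat \<Rightarrow> bit" and a assume a: "\<forall>i. a i \<in> part (quotient_superalgebra F J) (q i)"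
  note quot = algebra_image_quotient[of J "{..<d}" p, folded F_def, OF J]
  interpret A: algebra_image "\<lambda>c f w. c * f w" "free_carrier {..<d}" free_mul "\<lambda>x. J +>\<^bsub>F\<^esub> x"
    "quotient_superalgebra F J" by (rule quot)
  have "\<forall>i. \<exists>x. x \<in> free_carrier {..<d} \<and> a i = J +>\<^bsub>F\<^esub> x"
    using a free_part_carrier by (fastforce simp: quotient_superalgebra_def F_def)
  then obtain x where x: "\<And>i. x i \<in> free_carrier {..<d}" "\<And>i. a i = J +>\<^bsub>F\<^esub> x i"
    by metis
  then have a_eq: "a = (\<lambda>i. J +>\<^bsub>F\<^esub> x i)" by auto
  define f where "f = (\<Sum>ks\<in>orderings n. (\<lambda>w. koszul_sign q (nested_word ks) * c ks
    * monomial_value free_mul x (nested_word ks) w))"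
  have "f \<in> free_carrier {..<d}"
    unfolding f_def by (intro A.sum_C A.scale_C A.monomial_value_C x)
  moreover have "contains_double_product w" if "f w \<noteq> 0" for w
  proof (rule ccontr)
    assume "\<not> contains_double_product w"
    then obtain C h where Ch: "\<And>ks. length ks = n \<Longrightarrow> monomial_value free_mul x (nested_word ks) w
        = C * (\<Prod>j<n. x (2 * (ks ! j) + 2) (Var (h j)))"
      using nested_word_coefficient[of w n x] by blast
    have "f w = (\<Sum>ks\<in>orderings n. C * (koszul_sign q (nested_word ks) * c ks
        * (\<Prod>j<n. x (2 * (ks ! j) + 2) (Var (h j)))))"
      unfolding f_def sum_fun_apply by (rule sum.cong) (simp_all add: Ch length_orderings)
    also have "\<dots> = C * (\<Sum>ks\<in>orderings n. koszul_sign q (nested_word ks) * c ks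
        * (\<Prod>j<n. x (2 * (ks ! j) + 2) (Var (h j))))"
      by (simp add: sum_distrib_left)
    also have "\<dots> = 0"
    proof (cases "\<forall>j<n. h j < d")
      case True
      then have "(\<Sum>ks\<in>orderings n. koszul_sign q (nested_word ks) * c ks
          * (\<Prod>j<n. x (2 * (ks ! j) + 2) (Var (h j)))) = 0"
        using c[unfolded vanishing_coefficients_def, THEN spec[of _ q], THEN spec[of _ h],
            THEN spec[of _ "\<lambda>i g. x (2 * i + 2) (Var g)"]] by simp
      then show ?thesis by simp
    next
      case False
      then obtain j where j: "j < n" "\<not> h j < d" by blast
      \<comment> \<open>A letter outside the generating set has coefficient zero in every argument.\<close>
      have "x i (Var (h j)) = 0" for i
        using x(1)[of i] j(2) by (force simp: free_carrier_def)
      then have "(\<Prod>j<n. x (2 * (ks ! j) + 2) (Var (h j))) = 0" for ks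
        using j(1) by (intro prod_zero) auto
      then show ?thesis by (simp only: mult_zero_right sum.neutral_const)
    qed
    finally show False using that by simp
  qed
  ultimately have "f \<in> J"
    using metabelian_ideal_contains[of J "{..<d}" p f, folded F_def] J met by blast
  have "eval_poly (quotient_superalgebra F J) a (superization q (word_poly n c)) = J +>\<^bsub>F\<^esub> f"
    unfolding a_eq A.eval_poly_A[OF x(1)] superization_def f_def A.sum_word_poly ..
  also have "\<dots> = \<zero>\<^bsub>quotient_superalgebra F J\<^esub>"
    using quot(2)[OF \<open>f \<in> J\<close>] by (simp add: quotient_superalgebra_def FactRing_def)
  finally show "eval_poly (quotient_superalgebra F J) a (superization q (word_poly n c))
    = \<zero>\<^bsub>quotient_superalgebra F J\<^esub>" .
qed

text \<open>
The ideals intersected in the definition of \<open>free_superalgebra\<close> include the improper one; the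
intersection of an empty family would be the whole type, which is no ideal.
\<close>

lemma carrier_graded_ideal:
  fixes I :: "'x set" and p
  defines "F \<equiv> free_nonassoc_superalgebra I p :: ('k::field, 'x monomial \<Rightarrow> 'k) superalgebra"
  shows "graded_ideal (carrier F) F"
proof -
  note F = free_superalgebra_simps[of I p, where 'k = 'k, folded F_def]
  have "(0 :: 'x monomial \<Rightarrow> 'k) \<in> free_carrier I" by (simp add: free_carrier_def)
  then interpret A: algebra_image "\<lambda>c f w. c * f w" "free_carrier I" free_mul "\<lambda>x. x" F
    by unfold_locales
      (auto simp: F fun_eq_iff algebra_simps free_carrier_add free_carrier_scale free_carrier_mul
        free_mul_def split: monomial.split)
  interpret N: nonassoc_algebra F by (rule A.nonassoc_algebra_A)
  have part: "part F i \<subseteq> carrier F" for i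
    unfolding F(1) unfolding F_def using free_part_carrier by blast
  have "f \<in> part F 0 <+>\<^bsub>F\<^esub> part F 1" if f: "f \<in> carrier F" for f
  proof -
    define g where "g i w = (if sum_list (map p (letters w)) = i then f w else 0)" for i :: bit and w
    have "finite {w. g i w \<noteq> 0}" for i
      by (rule finite_subset[of _ "{w. f w \<noteq> 0}"]) (use f in \<open>auto simp: F free_carrier_def g_def\<close>)
    then have "g i \<in> part F i" for i
      using f by (auto simp: F_def free_nonassoc_superalgebra_def g_def)
    moreover have "f = g 0 + g 1"
      by (auto simp: fun_eq_iff g_def)
    ultimately show ?thesis unfolding set_add_def' F by blast
  qed
  moreover have "part F 0 <+>\<^bsub>F\<^esub> part F 1 \<subseteq> carrier F"
    using part A.add_C unfolding set_add_def' F by fastforce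
  moreover have "carrier F \<inter> part F i = part F i" for i using part by blast
  ultimately show ?thesis
    unfolding graded_ideal_def using N.carrier_is_submodule N.mult_closed by auto
qed

text \<open>
The zero algebra is the image of \<open>{0}\<close>, to which the results on even superalgebras apply.
\<close>

lemma trivial_quotient_in_super_class:
  fixes I :: "'x set" and p and \<epsilon> :: "'k::field"
  defines "F \<equiv> free_nonassoc_superalgebra I p :: ('k, 'x monomial \<Rightarrow> 'k) superalgebra"
  shows "quotient_superalgebra F (carrier F) \<in> super_class (V_eps \<epsilon>)"
proof (rule even_superalgebra_in_super_class)
  let ?J = "carrier F"
  note F = free_superalgebra_simps[of I p, where 'k = 'k, folded F_def]
  note quot = algebra_image_quotient[of ?J I p, folded F_def,
      OF graded_ideal_two_sided[OF carrier_graded_ideal[of I p, where 'k = 'k, folded F_def]]]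
  interpret A: algebra_image "\<lambda>c f w. c * f w" "free_carrier I" free_mul "\<lambda>x. ?J +>\<^bsub>F\<^esub> x"
    "quotient_superalgebra F ?J" by (rule quot)
  have coset: "?J +>\<^bsub>F\<^esub> x = ?J" if "x \<in> free_carrier I" for x
    using quot(2)[of x] that by (simp add: F)
  have z: "(0 :: 'x monomial \<Rightarrow> 'k) \<in> free_carrier I" by (rule A.zero_C)
  have zz: "free_mul 0 0 = (0 :: 'x monomial \<Rightarrow> 'k)"
    by (auto simp: fun_eq_iff free_mul_def split: monomial.split)
  have smult: "c \<odot>\<^bsub>quotient_superalgebra F ?J\<^esub> ?J = ?J" for c
    using A.smult_A[OF z, of c] coset[OF z] coset[OF A.scale_C[OF z]] by simp
  have mult: "?J \<otimes>\<^bsub>quotient_superalgebra F ?J\<^esub> ?J = ?J"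
    using A.mult_A[OF z z] coset[OF z] coset[OF A.mul_C[OF z z]] by simp
  have car: "carrier (quotient_superalgebra F ?J) = {?J}"
    using A.carrier_A z coset by auto
  have part: "part (quotient_superalgebra F ?J) i = {?J}" for i
  proof -
    have "(0 :: 'x monomial \<Rightarrow> 'k) \<in> part F i" by (simp add: F_def free_nonassoc_superalgebra_def)
    moreover have "part F i \<subseteq> free_carrier I" unfolding F_def using free_part_carrier by blast
    ultimately show ?thesis using coset by (auto simp: quotient_superalgebra_def)
  qed
  show "even_superalgebra_image (\<lambda>c f w. c * f w) {0} free_mul (\<lambda>x. ?J +>\<^bsub>F\<^esub> x)
      (quotient_superalgebra F ?J)"
    by (intro even_superalgebra_image.intro algebra_image.intro algebra_image_axioms.intro
          even_superalgebra_image_axioms.intro A.vector_space_axioms)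
      (simp_all add: A.add_A smult mult A.zero_A z zz car part coset flip: zero_fun_def)
  show "satisfies_V_eps (\<lambda>c f w. c * f w) {0 :: 'x monomial \<Rightarrow> 'k} free_mul \<epsilon>"
    by (simp add: satisfies_V_eps_def zz flip: zero_fun_def)
qed

lemma free_superalgebra_satisfies_superidentity:
  fixes d :: nat and c :: "nat list \<Rightarrow> 'k::field" and p
  assumes "vanishing_coefficients d n c"
  shows "satisfies_superidentity (free_superalgebra (V_eps \<epsilon>) {..<d} p) (word_poly n c)"
proof -
  let ?F = "free_nonassoc_superalgebra {..<d} p :: ('k, nat monomial \<Rightarrow> 'k) superalgebra"
  let ?\<J> = "{J. graded_ideal J ?F \<and> quotient_superalgebra ?F J \<in> super_class (V_eps \<epsilon>)}"
  have "carrier ?F \<in> ?\<J>"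
    using carrier_graded_ideal trivial_quotient_in_super_class by blast
  then have "two_sided_ideal (\<Inter>?\<J>) ?F"
    using graded_ideal_two_sided by (intro two_sided_ideal_Inter) blast+
  moreover have "metabelian_ideal {..<d} J" if "J \<in> ?\<J>" for J
    using that metabelian_ideal_if_quotient_in_V_eps[of J "{..<d}" p \<epsilon>] by blast
  then have "metabelian_ideal {..<d} (\<Inter>?\<J>)"
    unfolding metabelian_ideal_def by blast
  ultimately show ?thesis
    unfolding free_superalgebra_def Let_def using assms
    by (intro quotient_satisfies_superidentity)
qed

theorem theorem6:
  fixes \<epsilon> :: "'k::field_char_0"
  assumes "\<epsilon> \<in> {1, - 1}"
  shows "\<forall>r s :: nat. (rank_supervariety (V_eps \<epsilon>) r s :: ('k, 'k univ) superalgebra set)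
           \<noteq> super_class (V_eps \<epsilon>)"
proof (intro allI notI)
  fix r s :: nat
  assume eq: "(rank_supervariety (V_eps \<epsilon>) r s :: ('k, 'k univ) superalgebra set) = super_class (V_eps \<epsilon>)"
  have "model_superalgebra \<epsilon> \<in> super_class (V_eps \<epsilon>)"
    by (rule even_superalgebra_in_super_class[OF model_even_superalgebra_image
          model_satisfies_V_eps[OF assms]])
  then have model: "model_superalgebra \<epsilon> \<in> rank_supervariety (V_eps \<epsilon>) r s" using eq by simp
  show False
  proof (cases "r = 0 \<and> s = 0")
    case True
    \<comment> \<open>Only the zero superalgebra is admitted here, and the model is not zero.\<close>
    then have "range (model_code :: (coordinate \<Rightarrow> 'k) \<Rightarrow> _) = {model_code 0}"
      using model by (simp add: rank_supervariety_def model_superalgebra_def)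
    then have "model_code (\<lambda>_. 1 :: 'k) = model_code 0" by blast
    then have "(\<lambda>_. 1 :: 'k) = (0 :: coordinate \<Rightarrow> 'k)" by (rule injD[OF inj_model_code])
    then show False by (simp add: fun_eq_iff)
  next
    case False
    obtain n and c :: "nat list \<Rightarrow> 'k" where nz: "\<exists>ks\<in>orderings n. c ks \<noteq> 0"
      and c: "vanishing_coefficients (r + s) n c"
      by (rule exists_vanishing_coefficients)
    have "satisfies_superidentity (model_superalgebra \<epsilon>) (word_poly n c)"
      using model False multilinear_word_poly[of n c]
        free_superalgebra_satisfies_superidentity[OF c]
      by (auto simp: rank_supervariety_def generated_supervariety_def)
    then show False using nz word_poly_not_superidentity[OF assms] by blast
  qed
qed

end
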